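(* There is a universal constant $c>0$ such that for every $d\ge1$, every convex body $K\subset\mathbb{R}^d$ and every $p\in\mathrm{int}(K)$, \[\kappa'(K,p)>c\left(\frac{2}{\sqrt3}\right)^d.\]
   Context: A convex body in $\mathbb{R}^d$ is a compact convex set with non-empty interior. A positive homothet of $K$ is a set $\lambda K+v$ with $\lambda>0$, $v\in\mathbb{R}^d$. For $p\in\mathrm{int}(K)$, a strict Minkowski arrangement of $K$ with respect to $p$ is a family $\{v_i+\lambda_iK\}$ of positive homothets of $K$ such that $v_i+p\notin v_j+\lambda_jK$ for all distinct $i,j$. $\kappa'(K,p)$ is the largest number of homothets in a pairwise intersecting (any two members intersect) strict Minkowski arrangement of $K$ with respect to $p$.
   Formalization: The strictness condition is read as v_i+λ_i p ∉ v_j+λ_j K instead of v_i+p ∉ v_j+λ_j K; with the latter, for p≠0, small homothets v_i=−λ_i p give infinite families, so no largest number exists. κ' is taken as a supremum. *)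

theory Defs
  imports "HOL-Analysis.Analysis" "HOL-Library.Extended_Real"
begin

text \<open>Euclidean d-space R^d is modelled as the set of real sequences that vanish
  from index d on, i.e. x = (x 0, ..., x (d-1), 0, 0, ...). This is needed because
  the dimension d is quantified inside the statement (after the constant c).\<close>

definition Rd :: "nat \<Rightarrow> (nat \<Rightarrow> real) set" where
  "Rd d = {x. \<forall>i\<ge>d. x i = 0}"

definition dist_d :: "nat \<Rightarrow> (nat \<Rightarrow> real) \<Rightarrow> (nat \<Rightarrow> real) \<Rightarrow> real" where
  "dist_d d x y = sqrt (\<Sum>i<d. (x i - y i)^2)"

definition int_d :: "nat \<Rightarrow> (nat \<Rightarrow> real) set \<Rightarrow> (nat \<Rightarrow> real) set" where
  "int_d d K = {p \<in> Rd d. \<exists>e>0. {x \<in> Rd d. dist_d d p x < e} \<subseteq> K}"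

definition convex_d :: "(nat \<Rightarrow> real) set \<Rightarrow> bool" where
  "convex_d K \<longleftrightarrow> (\<forall>x\<in>K. \<forall>y\<in>K. \<forall>t::real. 0 \<le> t \<and> t \<le> 1 \<longrightarrow> (\<lambda>i. (1 - t) * x i + t * y i) \<in> K)"

text \<open>Compactness is the library notion (product topology on nat => real), which on
  the finite-dimensional subspace R^d coincides with the Euclidean topology.\<close>
definition convex_body :: "nat \<Rightarrow> (nat \<Rightarrow> real) set \<Rightarrow> bool" where
  "convex_body d K \<longleftrightarrow> K \<subseteq> Rd d \<and> compact K \<and> convex_d K \<and> int_d d K \<noteq> {}"

definition homothet :: "(nat \<Rightarrow> real) \<Rightarrow> real \<Rightarrow> (nat \<Rightarrow> real) set \<Rightarrow> (nat \<Rightarrow> real) set" where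
  "homothet v lam K = (\<lambda>x. (\<lambda>i. v i + lam * x i)) ` K"

definition pi_strict_minkowski ::
  "nat \<Rightarrow> (nat \<Rightarrow> real) set \<Rightarrow> (nat \<Rightarrow> real) \<Rightarrow> nat \<Rightarrow> (nat \<Rightarrow> nat \<Rightarrow> real) \<Rightarrow> (nat \<Rightarrow> real) \<Rightarrow> bool" where
  "pi_strict_minkowski d K p n v lam \<longleftrightarrow>
     (\<forall>j<n. v j \<in> Rd d \<and> lam j > 0) \<and>
     (\<forall>i<n. \<forall>j<n. i \<noteq> j \<longrightarrow> (\<lambda>k. v i k + lam i * p k) \<notin> homothet (v j) (lam j) K) \<and>
     (\<forall>i<n. \<forall>j<n. homothet (v i) (lam i) K \<inter> homothet (v j) (lam j) K \<noteq> {})"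

definition kappa' :: "nat \<Rightarrow> (nat \<Rightarrow> real) set \<Rightarrow> (nat \<Rightarrow> real) \<Rightarrow> ereal" where
  "kappa' d K p = Sup {ereal (real n) | n. \<exists>v lam. pi_strict_minkowski d K p n v lam}"

end

theory Submission
  imports Defs "HOL-Probability.Probability"
begin

text \<open>Translate \<open>p\<close> to the origin. Among \<open>x, y \<in> K\<close>, the proportion of pairs with \<open>x - y \<in> K\<close> is at most
  \<open>(\<surd>3 / 2)\<^sup>d\<close>: this is Young's convolution inequality with its sharp constant at exponents \<open>(3/2, 3/2, 3/2)\<close>,
  applied to the indicator of \<open>K\<close>. A greedy choice then yields about \<open>(2 / \<surd>3)\<^sup>d\<close> points \<open>x\<^sub>i \<in> K\<close> whose
  differences avoid \<open>K\<close>, and the translates \<open>K - x\<^sub>i\<close>, which all contain the origin, form the arrangement.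
  The sharp inequality tensorizes, so only the one-dimensional case is needed, where it follows by
  monotone transport to the Gaussian. To avoid fractional powers, Young's inequality is stated for the
  functions \<open>f\<^sup>2, g\<^sup>2, h\<^sup>2\<close> in terms of the integrals of \<open>f\<^sup>3, g\<^sup>3, h\<^sup>3\<close>.\<close>

text \<open>For an indicator every norm is a power of the volume, so Young's inequality bounds the
  volume of the pairs by a constant times \<open>vol(K)^2\<close> for any three exponents whose
  reciprocals sum to 2. With the elementary constant 1 this says nothing; the whole gain is the
  sharp constant, a \<open>d\<close>-th power, which for three equal exponents has base
  \<open>sqrt 3 / 2\<close>. Identical Gaussians attain it, hence the normal law as the target of
  the transport. Transport wants continuous positive densities, whereas the functions met in the
  induction on the dimension are norms of slices: bounded, compactly supported, possibly zero.
  Approximation bridges the gap, and Fatou's lemma suffices because only an upper bound has to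
  survive the limit. The relation \<open>x - y \<in> K\<close> is not symmetric, while an
  arrangement forbids it in both directions. Symmetrizing costs a factor 2, the greedy choice a
  factor 4, and a last factor 2 buys the strict inequality, which gives
  \<open>c = 1/16\<close>.\<close>

section \<open>Distribution functions and monotone transport on the line\<close>

text \<open>Used both for the given density and for the Gaussian: since the two distribution
  functions have the same open range \<open>{0<..<1}\<close>, one can be composed with the inverse
  of the other on the whole line.\<close>

lemma cdf_density:
  fixes \<phi> :: "real \<Rightarrow> real"
  assumes cont: "continuous_on UNIV \<phi>" and pos: "\<And>x. 0 < \<phi> x"
    and int1: "(\<integral>\<^sup>+x. \<phi> x \<partial>lborel) = 1"
  defines "F \<equiv> cdf (density lborel (\<lambda>x. ennreal (\<phi> x)))"
  shows has_real_derivative_cdf_density: "(F has_real_derivative \<phi> x) (at x)"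
    and strict_mono_cdf_density: "strict_mono F"
    and range_cdf_density: "range F = {0<..<1}"
proof -
  define M where "M = density lborel (\<lambda>x. ennreal (\<phi> x))"
  have [measurable]: "\<phi> \<in> borel_measurable borel"
    using cont by (rule borel_measurable_continuous_onI)
  interpret prob_space M
    by standard (simp add: M_def emeasure_density int1)
  interpret real_distribution M
    by standard (simp_all add: M_def)
  have F: "F = cdf M" by (simp add: F_def M_def)
  have diff: "F y - F x = integral {x..y} \<phi>" if "x < y" for x y
  proof -
    have I: "set_integrable lborel {x..y} \<phi>"
      by (intro borel_integrable_atLeastAtMost' continuous_on_subset[OF cont]) auto
    have "emeasure M {x<..y} = (\<integral>\<^sup>+t. ennreal (\<phi> t) * indicator {x<..y} t \<partial>lborel)"
      by (simp add: M_def emeasure_density)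
    also have "\<dots> = (\<integral>\<^sup>+t. ennreal (indicator {x..y} t *\<^sub>R \<phi> t) \<partial>lborel)"
    proof (rule nn_integral_cong_AE)
      show "AE t in lborel. ennreal (\<phi> t) * indicator {x<..y} t = ennreal (indicator {x..y} t *\<^sub>R \<phi> t)"
        using AE_lborel_singleton[of x] by eventually_elim (auto simp: indicator_def)
    qed
    also have "\<dots> = ennreal (LINT t:{x..y}|lborel. \<phi> t)"
      unfolding set_lebesgue_integral_def
      using I less_imp_le[OF pos] by (intro nn_integral_eq_integral) (auto simp: set_integrable_def)
    also have "(LINT t:{x..y}|lborel. \<phi> t) = integral {x..y} \<phi>"
      using I by (rule set_borel_integral_eq_integral)
    finally have "emeasure M {x<..y} = ennreal (integral {x..y} \<phi>)" .
    moreover have "0 \<le> integral {x..y} \<phi>"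
      by (intro Henstock_Kurzweil_Integration.integral_nonneg integrable_continuous_interval
          continuous_on_subset[OF cont] less_imp_le[OF pos]) auto
    ultimately show ?thesis
      using cdf_diff_eq[OF that] by (simp add: F measure_def)
  qed
  show deriv: "(F has_real_derivative \<phi> x) (at x)" for x
  proof -
    have "((\<lambda>y. integral {x-1..y} \<phi>) has_real_derivative \<phi> x) (at x within {x-1..x+1})"
      by (intro integral_has_real_derivative continuous_on_subset[OF cont]) auto
    hence "((\<lambda>y. integral {x-1..y} \<phi>) has_real_derivative \<phi> x) (at x)"
      by (subst (asm) at_within_interior) auto
    hence "((\<lambda>y. F (x-1) + integral {x-1..y} \<phi>) has_real_derivative \<phi> x) (at x)"
      by (auto intro!: derivative_eq_intros)
    moreover have "eventually (\<lambda>y. y \<in> {x-1<..}) (nhds x)"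
      by (intro eventually_nhds_in_open) auto
    hence "eventually (\<lambda>y. F (x-1) + integral {x-1..y} \<phi> = F y) (nhds x)"
    proof eventually_elim
      case (elim y)
      thus ?case using diff[of "x-1" y] by simp
    qed
    ultimately show ?thesis
      by (simp add: DERIV_cong_ev)
  qed
  show mono: "strict_mono F"
    using DERIV_pos_imp_increasing[of _ _ F] deriv pos by (metis strict_mono_def)
  have lim0: "(F \<longlongrightarrow> 0) at_bot" and lim1: "(F \<longlongrightarrow> 1) at_top"
    unfolding F by (fact cdf_lim_at_bot cdf_lim_at_top_prob)+
  have contF: "continuous_on UNIV F"
    using deriv by (auto intro!: continuous_at_imp_continuous_on DERIV_isCont)
  show "range F = {0<..<1}"
  proof (intro equalityI subsetI)
    fix y assume "y \<in> range F"
    then obtain x where y: "y = F x" by auto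
    have "0 \<le> F (x-1)" "F (x+1) \<le> 1"
      unfolding F by (rule cdf_nonneg cdf_bounded_prob)+
    moreover have "F (x-1) < F x" "F x < F (x+1)"
      using mono by (auto simp: strict_mono_def)
    ultimately show "y \<in> {0<..<1}" using y by auto
  next
    fix y :: real assume y: "y \<in> {0<..<1}"
    obtain a where a: "F a < y"
      using order_tendstoD(2)[OF lim0, of y] y by (auto simp: eventually_at_bot_linorder)
    obtain b where b: "y < F b"
      using order_tendstoD(1)[OF lim1, of y] y by (auto simp: eventually_at_top_linorder)
    have "a \<le> b" using a b mono by (meson linear not_le order.strict_trans strict_mono_less)
    then obtain x where "F x = y"
      using IVT'[of F a y b] a b continuous_on_subset[OF contF] by auto
    thus "y \<in> range F" by auto
  qed
qed

text \<open>With distribution functions \<open>F\<close> of \<open>\<phi>\<close> and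
  \<open>G\<close> of the normal law, the map is the inverse of \<open>G\<close> after
  \<open>F\<close>. Differentiating \<open>G (T x) = F x\<close> gives the density equation.\<close>

lemma transport_to_std_normal:
  fixes \<phi> :: "real \<Rightarrow> real"
  assumes cont: "continuous_on UNIV \<phi>" and pos: "\<And>x. 0 < \<phi> x"
    and int1: "(\<integral>\<^sup>+x. \<phi> x \<partial>lborel) = 1"
  obtains T T' where "\<And>x. (T has_real_derivative T' x) (at x)" "\<And>x. 0 < T' x"
    "\<And>x. \<phi> x = std_normal_density (T x) * T' x"
proof -
  define F where "F = cdf (density lborel (\<lambda>x. ennreal (\<phi> x)))"
  define G where "G = cdf (density lborel (\<lambda>x. ennreal (std_normal_density x)))"
  note F = cdf_density[OF assms, folded F_def]
  have contN: "continuous_on UNIV std_normal_density"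
    unfolding normal_density_def by (auto intro!: continuous_intros)
  have intN: "(\<integral>\<^sup>+x. std_normal_density x \<partial>lborel) = 1"
    by (simp add: nn_integral_eq_integral)
  have posN: "0 < std_normal_density x" for x
    by (rule normal_density_pos) simp
  note G = cdf_density[OF contN posN intN, folded G_def]
  define H where "H = inv G"
  have HG: "H (G x) = x" for x
    unfolding H_def using G(2) by (simp add: strict_mono_imp_inj_on)
  have GH: "G (H y) = y" if "0 < y" "y < 1" for y
    unfolding H_def using that G(3) by (intro f_inv_into_f) auto
  define T where "T = (\<lambda>x. H (F x))"
  have FI: "0 < F x" "F x < 1" for x using F(3) by auto
  have GT: "G (T x) = F x" for x
    unfolding T_def by (intro GH FI)
  have dH: "(H has_real_derivative inverse (std_normal_density (T x))) (at (F x))" for x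
  proof (rule DERIV_inverse_function[where f = G and a = 0 and b = 1])
    show "(G has_real_derivative std_normal_density (T x)) (at (H (F x)))"
      using G(1) by (simp add: T_def)
    show "isCont H (F x)"
      using isCont_inverse_function[of 1 "T x" H G] HG DERIV_isCont[OF G(1)] by (simp add: GT)
  qed (use FI GH posN[of "T x"] in auto)
  show thesis
  proof (rule that)
    show "(T has_real_derivative inverse (std_normal_density (T x)) * \<phi> x) (at x)" for x
      unfolding T_def using DERIV_chain2[OF dH F(1)] by (simp add: T_def)
    show "0 < inverse (std_normal_density (T x)) * \<phi> x" for x
      using pos posN by simp
    show "\<phi> x = std_normal_density (T x) * (inverse (std_normal_density (T x)) * \<phi> x)" for x
      using posN[of "T x"] by simp
  qed
qed

section \<open>Change of variables in the plane\<close>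

text \<open>The left side is the integral of \<open>f\<close> over \<open>range g\<close>. An
  inequality is all that an upper bound requires, and it spares a proof that the map built from the
  transports is onto.\<close>

lemma nn_integral_change_of_variables_le:
  fixes f :: "real^'n::{finite,wellorder} \<Rightarrow> real" and g :: "real^'n::_ \<Rightarrow> real^'n::_"
  assumes der: "\<And>x. (g has_derivative g' x) (at x)" and inj: "inj g"
    and f: "integrable lborel f" "\<And>x. 0 \<le> f x"
  shows "(\<integral>\<^sup>+x. \<bar>det (matrix (g' x))\<bar> * f (g x) \<partial>lborel) \<le> (\<integral>\<^sup>+x. f x \<partial>lborel)"
proof -
  have absU: "f absolutely_integrable_on UNIV"
    using f(1) by (simp add: set_integrable_def integrable_completion borel_measurable_integrable)
  have "range g \<in> sets lebesgue"
    using der by (intro differentiable_image_in_sets_lebesgue) 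
      (auto simp: differentiable_on_def differentiable_def intro: has_derivative_at_withinI)
  hence absR: "f absolutely_integrable_on range g"
    by (intro set_integrable_subset[OF absU]) auto
  define b where "b = integral (range g) f"
  \<comment> \<open>The scalar integrand is wrapped as a vector in \<open>real^1\<close>, the form
    in which the change of variables formula is phrased.\<close>
  have "(\<lambda>x. \<bar>det (matrix (g' x))\<bar> *\<^sub>R (vec (f (g x)) :: real^1)) absolutely_integrable_on UNIV \<and>
        integral UNIV (\<lambda>x. \<bar>det (matrix (g' x))\<bar> *\<^sub>R (vec (f (g x)) :: real^1)) = vec b"
    using has_absolute_integral_change_of_variables[of UNIV g g' "\<lambda>x. vec (f x) :: real^1" "vec b"]
      der inj absR by (simp add: absolutely_integrable_on_1_iff integral_on_1_eq b_def)
  hence "(\<lambda>x. \<bar>det (matrix (g' x))\<bar> * f (g x)) absolutely_integrable_on UNIV"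
    "integral UNIV (\<lambda>x. \<bar>det (matrix (g' x))\<bar> * f (g x)) = b"
    by (simp_all add: absolutely_integrable_on_1_iff integral_on_1_eq)
  hence "((\<lambda>x. \<bar>det (matrix (g' x))\<bar> * f (g x)) has_integral b) UNIV"
    by (auto simp: has_integral_iff set_lebesgue_integral_eq_integral(1))
  from nn_integral_has_integral_lebesgue'[OF _ this]
  have "(\<integral>\<^sup>+x. \<bar>det (matrix (g' x))\<bar> * f (g x) \<partial>lborel) = ennreal b"
    using f(2) by simp
  also have "b \<le> integral UNIV f"
    unfolding b_def
    using absR absU f(2) by (intro integral_subset_le set_lebesgue_integral_eq_integral(1)) auto
  also have "ennreal (integral UNIV f) = (\<integral>\<^sup>+x. f x \<partial>lborel)"
    using nn_integral_has_integral_lebesgue'[of UNIV f "integral UNIV f"] f(2) absU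
    by (simp add: has_integral_iff set_lebesgue_integral_eq_integral(1))
  finally show ?thesis by (simp add: ennreal_leI)
qed

lemma bounded_linear_vector_2: "bounded_linear (\<lambda>(x, y). vector [x, y] :: real^2)"
  by (intro linear_conv_bounded_linear[THEN iffD1] linearI) (auto simp: vec_eq_iff forall_2)

lemma distr_lborel_vec2:
  "distr lborel borel (\<lambda>(x, y). vector [x, y] :: real^2) = lborel"
proof (rule lborel_eqI[symmetric])
  have [measurable]: "(\<lambda>(x, y). vector [x, y] :: real^2) \<in> borel_measurable borel"
    by (intro borel_measurable_continuous_onI linear_continuous_on bounded_linear_vector_2)
  fix l u :: "real^2" assume lu: "\<And>b. b \<in> Basis \<Longrightarrow> l \<bullet> b \<le> u \<bullet> b"
  have le: "l $ i \<le> u $ i" for i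
    using lu[of "axis i 1"] by (simp add: inner_axis)
  have "emeasure (distr lborel borel (\<lambda>(x, y). vector [x, y] :: real^2)) (box l u)
    = emeasure lborel ((\<lambda>(x, y). vector [x, y] :: real^2) -` box l u)"
    by (subst emeasure_distr) auto
  also have "(\<lambda>(x, y). vector [x, y] :: real^2) -` box l u = {l$1<..<u$1} \<times> {l$2<..<u$2}"
    by (auto simp: mem_box_cart forall_2)
  also have "emeasure lborel \<dots> = ennreal (u$1 - l$1) * ennreal (u$2 - l$2)"
    using le by (simp flip: lborel_prod add: lborel.emeasure_pair_measure_Times)
  also have "\<dots> = ennreal (\<Prod>i\<in>UNIV. u$i - l$i)"
    using le by (simp add: UNIV_2 ennreal_mult)
  also have "(\<Prod>i\<in>UNIV. u$i - l$i) = (\<Prod>b\<in>Basis. (u - l) \<bullet> b)"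
    by (simp add: Basis_vec_def UNION_singleton_eq_range prod.reindex inj_on_def axis_eq_axis inner_axis)
  finally show "emeasure (distr lborel borel (\<lambda>(x, y). vector [x, y] :: real^2)) (box l u) =
    ennreal (\<Prod>b\<in>Basis. (u - l) \<bullet> b)" .
qed simp

text \<open>Carries the inequality from \<open>real^2\<close>, where determinants live, to pairs,
  where Fubini's theorem applies, along the measure-preserving linear bijection \<open>v\<close>
  with inverse \<open>u\<close>. The functions \<open>a\<close>, \<open>b\<close>, \<open>c\<close>,
  \<open>d\<close> are the partial derivatives of \<open>G\<close>.\<close>

lemma nn_integral_change_of_variables_plane_le:
  fixes w :: "real \<times> real \<Rightarrow> real" and G :: "real \<times> real \<Rightarrow> real \<times> real"
  assumes der: "\<And>z. (G has_derivative (\<lambda>(h, k). (a z * h + b z * k, c z * h + d z * k))) (at z)"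
    and inj: "inj G"
    and w: "integrable lborel w" "\<And>z. 0 \<le> w z"
    and [measurable]: "(\<lambda>z. \<bar>a z * d z - b z * c z\<bar> * w (G z)) \<in> borel_measurable borel"
  shows "(\<integral>\<^sup>+z. \<bar>a z * d z - b z * c z\<bar> * w (G z) \<partial>lborel) \<le> (\<integral>\<^sup>+z. w z \<partial>lborel)"
proof -
  have [measurable]: "w \<in> borel_measurable borel"
    using borel_measurable_integrable[OF w(1)] by simp
  define v :: "real \<times> real \<Rightarrow> real^2" where "v = (\<lambda>(x, y). vector [x, y])"
  define u :: "real^2 \<Rightarrow> real \<times> real" where "u = (\<lambda>q. (q$1, q$2))"
  have uv [simp]: "u (v z) = z" for z
    by (simp add: u_def v_def split: prod.splits)
  have vu [simp]: "v (u q) = q" for q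
    by (simp add: u_def v_def vec_eq_iff forall_2)
  have bl_u: "bounded_linear u"
    unfolding u_def by (intro bounded_linear_Pair bounded_linear_vec_nth)
  have bl_v: "bounded_linear v"
    unfolding v_def by (rule bounded_linear_vector_2)
  have [measurable]: "v \<in> borel_measurable borel" "u \<in> borel_measurable borel"
    using bl_u bl_v by (auto intro: borel_measurable_continuous_onI linear_continuous_on)
  have lb: "distr lborel borel v = lborel"
    unfolding v_def by (rule distr_lborel_vec2)
  define g where "g = (\<lambda>q. v (G (u q)))"
  define g' where "g' = (\<lambda>q p. v (case u p of (h, k) \<Rightarrow>
    (a (u q) * h + b (u q) * k, c (u q) * h + d (u q) * k)))"
  have det: "det (matrix (g' (v z))) = a z * d z - b z * c z" for z
    by (simp add: det_2 matrix_def g'_def uv) (simp add: u_def v_def axis_def)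
  have "(\<integral>\<^sup>+z. \<bar>a z * d z - b z * c z\<bar> * w (G z) \<partial>lborel)
    = (\<integral>\<^sup>+q. \<bar>a (u q) * d (u q) - b (u q) * c (u q)\<bar> * w (G (u q)) \<partial>distr lborel borel v)"
    by (subst nn_integral_distr) auto
  also have "\<dots> = (\<integral>\<^sup>+q. \<bar>det (matrix (g' q))\<bar> * w (u (g q)) \<partial>lborel)"
    unfolding lb by (intro nn_integral_cong) (subst det[symmetric], simp add: g_def)
  also have "\<dots> \<le> (\<integral>\<^sup>+q. w (u q) \<partial>lborel)"
  proof (rule nn_integral_change_of_variables_le)
    show "(g has_derivative g' q) (at q)" for q
      unfolding g_def g'_def
      by (rule bounded_linear.has_derivative[OF bl_v]
          has_derivative_compose[OF bounded_linear_imp_has_derivative[OF bl_u] der])+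
    show "inj g"
      unfolding g_def by (rule injI) (metis inj injD uv vu)
    show "integrable lborel (\<lambda>q. w (u q))"
      by (subst lb[symmetric]) (simp add: integrable_distr_eq w(1))
  qed (use w in auto)
  also have "\<dots> = (\<integral>\<^sup>+z. w z \<partial>lborel)"
    by (subst lb[symmetric], subst nn_integral_distr) auto
  finally show ?thesis .
qed

section \<open>The sharp inequality on the line for continuous positive functions\<close>

lemma arith_geo_mean_3:
  fixes x y z :: real
  assumes "0 \<le> x" "0 \<le> y" "0 \<le> z"
  shows "27 * (x * y * z) \<le> (x + y + z) ^ 3"
proof -
  \<comment> \<open>The first summand equals \<open>x^3 + y^3 + z^3 - 3 x y z\<close>; the second is
    three times the sum of the six terms \<open>x^2 y\<close> minus \<open>18 x y z\<close>.\<close>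
  have "(x + y + z) ^ 3 - 27 * (x * y * z) =
    (x + y + z) / 2 * ((x - y)\<^sup>2 + (y - z)\<^sup>2 + (z - x)\<^sup>2) +
    3 * (x * (y - z)\<^sup>2 + y * (z - x)\<^sup>2 + z * (x - y)\<^sup>2)"
    by (simp add: field_simps power2_eq_square power3_eq_cube)
  also have "\<dots> \<ge> 0"
    using assms by (intro add_nonneg_nonneg mult_nonneg_nonneg) auto
  finally show ?thesis by simp
qed

text \<open>The value is \<open>2 pi / sqrt D\<close>, where \<open>D = 3/4\<close> is the
  determinant of the form \<open>x^2 + x y + y^2\<close>.\<close>

lemma nn_integral_gaussian_hexagonal:
  "(\<integral>\<^sup>+z. exp (- ((fst z)\<^sup>2 + fst z * snd z + (snd z)\<^sup>2) / 2) \<partial>(lborel :: (real \<times> real) measure))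
    = ennreal (4 * pi / sqrt 3)"
proof -
  \<comment> \<open>Completing the square, \<open>x^2 + x y + y^2 = (y + x/2)^2 + 3/4 x^2\<close>:
    the marginal in \<open>x\<close> has variance \<open>4/3\<close>, and given \<open>x\<close>,
    the variable \<open>y\<close> has mean \<open>- x / 2\<close> and variance 1.\<close>
  define s where "s = 2 / sqrt (3::real)"
  have s: "0 < s" "s\<^sup>2 = 4 / 3" by (simp_all add: s_def power_divide)
  have nd: "(\<integral>\<^sup>+y. normal_density m t y \<partial>lborel) = 1" if "t > 0" for m t
    using that by (simp add: nn_integral_eq_integral)
  have split: "exp (- (x\<^sup>2 + x * y + y\<^sup>2) / 2) =
    (2 * pi * s * normal_density 0 s x) * normal_density (- x / 2) 1 y" for x y
  proof -
    have "sqrt (2 * pi * s\<^sup>2) = sqrt (2 * pi) * s"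
      using s(1) by (simp add: real_sqrt_mult)
    hence "(2 * pi * s * normal_density 0 s x) * normal_density (- x / 2) 1 y =
      (2 * pi * s) / (sqrt (2 * pi) * s * sqrt (2 * pi)) *
      (exp (- x\<^sup>2 / (2 * s\<^sup>2)) * exp (- (y + x / 2)\<^sup>2 / 2))"
      by (simp add: normal_density_def)
    also have "(2 * pi * s) / (sqrt (2 * pi) * s * sqrt (2 * pi)) = 1"
      using s(1) by (simp add: field_simps)
    also have "exp (- x\<^sup>2 / (2 * s\<^sup>2)) * exp (- (y + x / 2)\<^sup>2 / 2) =
      exp (- (x\<^sup>2 + x * y + y\<^sup>2) / 2)"
      unfolding exp_add[symmetric] s(2)
      by (rule arg_cong[of _ _ exp]) (simp add: field_simps power2_eq_square)
    finally show ?thesis by simp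
  qed
  have "(\<integral>\<^sup>+z. exp (- ((fst z)\<^sup>2 + fst z * snd z + (snd z)\<^sup>2) / 2) \<partial>(lborel :: (real \<times> real) measure))
    = (\<integral>\<^sup>+x. \<integral>\<^sup>+y. exp (- (x\<^sup>2 + x * y + y\<^sup>2) / 2) \<partial>lborel \<partial>lborel)"
    by (subst lborel_prod[symmetric], subst lborel.nn_integral_fst[symmetric]) auto
  also have "\<dots> = (\<integral>\<^sup>+x. ennreal (2 * pi * s) * normal_density 0 s x \<partial>lborel)"
  proof (rule nn_integral_cong)
    fix x :: real
    have "(\<integral>\<^sup>+y. exp (- (x\<^sup>2 + x * y + y\<^sup>2) / 2) \<partial>lborel) =
      (\<integral>\<^sup>+y. ennreal (2 * pi * s * normal_density 0 s x) * normal_density (- x / 2) 1 y \<partial>lborel)"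
      unfolding split using s(1) by (simp add: ennreal_mult)
    also have "\<dots> = ennreal (2 * pi * s * normal_density 0 s x)"
      by (subst nn_integral_cmult) (simp_all only: nd, simp_all)
    finally show "(\<integral>\<^sup>+y. exp (- (x\<^sup>2 + x * y + y\<^sup>2) / 2) \<partial>lborel) =
      ennreal (2 * pi * s) * normal_density 0 s x"
      using s(1) by (simp add: ennreal_mult)
  qed
  also have "\<dots> = ennreal (2 * pi * s)"
    by (simp add: nn_integral_cmult nd s)
  finally show ?thesis by (simp add: s_def)
qed

text \<open>Barthe's transport argument. If \<open>T\<^sub>1, T\<^sub>2, T\<^sub>3\<close> push \<open>f\<^sup>3, g\<^sup>3, h\<^sup>3\<close> forward to the
  standard normal law, the map \<open>G\<close> below is injective, its Jacobian determinant dominates a multiple of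
  \<open>(T\<^sub>1' T\<^sub>2' T\<^sub>3')\<^bsup>2/3\<^esup>\<close> by the inequality of arithmetic and geometric means, and the Gaussian factors are
  dominated by the Gaussian of the form \<open>P\<^sup>2 + P Q + Q\<^sup>2\<close>. All constants are
  sharp for Gaussian \<open>f, g, h\<close>.\<close>
lemma sharp_young_continuous:
  fixes f g h :: "real \<Rightarrow> real"
  assumes cont: "continuous_on UNIV f" "continuous_on UNIV g" "continuous_on UNIV h"
    and pos: "\<And>x. 0 < f x" "\<And>x. 0 < g x" "\<And>x. 0 < h x"
    and int: "(\<integral>\<^sup>+x. f x ^ 3 \<partial>lborel) = 1" "(\<integral>\<^sup>+x. g x ^ 3 \<partial>lborel) = 1"
      "(\<integral>\<^sup>+x. h x ^ 3 \<partial>lborel) = 1"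
  shows "(\<integral>\<^sup>+x. \<integral>\<^sup>+y. (f x * g y * h (x - y))\<^sup>2 \<partial>lborel \<partial>lborel) \<le> ennreal (sqrt 3 / 2)"
proof -
  have main: "\<exists>T T'. (\<forall>x. (T has_real_derivative T' x) (at x)) \<and> (\<forall>x. 0 < T' x) \<and>
      (\<forall>x. k x ^ 3 = std_normal_density (T x) * T' x) \<and>
      T \<in> borel_measurable borel \<and> T' \<in> borel_measurable borel"
    if "continuous_on UNIV k" "\<And>x. 0 < k x" "(\<integral>\<^sup>+x. k x ^ 3 \<partial>lborel) = 1" for k :: "real \<Rightarrow> real"
  proof -
    have "continuous_on UNIV (\<lambda>x. k x ^ 3)" "\<And>x. 0 < k x ^ 3"
      using that by (auto intro: continuous_intros)
    from transport_to_std_normal[OF this that(3)] obtain T T' where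
      T: "\<And>x. (T has_real_derivative T' x) (at x)" "\<And>x. 0 < T' x"
        "\<And>x. k x ^ 3 = std_normal_density (T x) * T' x" by blast
    have [measurable]: "k \<in> borel_measurable borel"
      using that(1) by (rule borel_measurable_continuous_onI)
    have [measurable]: "T \<in> borel_measurable borel"
      by (intro borel_measurable_continuous_onI continuous_at_imp_continuous_on ballI DERIV_isCont[OF T(1)])
    \<comment> \<open>Measurability of \<open>T'\<close> is read off by solving the density equation
      for it.\<close>
    have "0 < std_normal_density x" for x by (rule normal_density_pos) simp
    hence "T' = (\<lambda>x. k x ^ 3 / std_normal_density (T x))"
      by (auto simp: T(3) fun_eq_iff less_imp_neq[symmetric])
    also have "\<dots> \<in> borel_measurable borel" by measurable
    finally have "T' \<in> borel_measurable borel" .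
    with T \<open>T \<in> borel_measurable borel\<close> show ?thesis by blast
  qed
  obtain T1 T1' where T1: "\<And>x. (T1 has_real_derivative T1' x) (at x)" "\<And>x. 0 < T1' x"
      "\<And>x. f x ^ 3 = std_normal_density (T1 x) * T1' x"
    and [measurable]: "T1 \<in> borel_measurable borel" "T1' \<in> borel_measurable borel"
    using main[OF cont(1) pos(1) int(1)] by auto
  obtain T2 T2' where T2: "\<And>x. (T2 has_real_derivative T2' x) (at x)" "\<And>x. 0 < T2' x"
      "\<And>x. g x ^ 3 = std_normal_density (T2 x) * T2' x"
    and [measurable]: "T2 \<in> borel_measurable borel" "T2' \<in> borel_measurable borel"
    using main[OF cont(2) pos(2) int(2)] by auto
  obtain T3 T3' where T3: "\<And>x. (T3 has_real_derivative T3' x) (at x)" "\<And>x. 0 < T3' x"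
      "\<And>x. h x ^ 3 = std_normal_density (T3 x) * T3' x"
    and [measurable]: "T3 \<in> borel_measurable borel" "T3' \<in> borel_measurable borel"
    using main[OF cont(3) pos(3) int(3)] by auto
  have [measurable]: "f \<in> borel_measurable borel" "g \<in> borel_measurable borel" "h \<in> borel_measurable borel"
    using cont by (auto intro: borel_measurable_continuous_onI)
  have mono: "strict_mono T" if "\<And>x. (T has_real_derivative T' x) (at x)" "\<And>x. 0 < T' x" for T T' :: "real \<Rightarrow> real"
    using DERIV_pos_imp_increasing[of _ _ T] that by (metis strict_mono_def)
  \<comment> \<open>The linear forms \<open>x\<close>, \<open>y\<close>, \<open>x - y\<close> have
    gradients \<open>(1,0)\<close>, \<open>(0,1)\<close>, \<open>(1,-1)\<close>. \<open>G\<close>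
    sums, over the three forms, the gradient times \<open>2/3\<close> times the transport evaluated
    at the form; \<open>2/3\<close> is the exponent that turns \<open>f^3\<close> into
    \<open>f^2\<close>.\<close>
  define G where "G = (\<lambda>(x, y). (2/3 * (T1 x + T3 (x - y)), 2/3 * (T2 y - T3 (x - y))))"
  \<comment> \<open>Up to a factor, \<open>P^2 + P Q + Q^2\<close> has the inverse matrix of
    \<open>x^2 + y^2 + (x - y)^2\<close>.\<close>
  define w where "w = (\<lambda>z. exp (- ((fst z)\<^sup>2 + fst z * snd z + (snd z)\<^sup>2) / (2::real)))"
  \<comment> \<open>The Jacobian matrix of \<open>G\<close> is symmetric, with diagonal
    \<open>a\<close>, \<open>d\<close> and off-diagonal entry \<open>b\<close>.\<close>
  define a where "a = (\<lambda>(x, y). 2/3 * (T1' x + T3' (x - y)))"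
  define b where "b = (\<lambda>(x, y). - (2/3 * T3' (x - y)))"
  define d where "d = (\<lambda>(x, y). 2/3 * (T2' y + T3' (x - y)))"
  define J where "J = (\<lambda>z. \<bar>a z * d z - b z * b z\<bar>)"
  have [measurable]: "a \<in> borel_measurable borel" "b \<in> borel_measurable borel" "d \<in> borel_measurable borel"
    "w \<in> borel_measurable borel" "G \<in> borel_measurable borel"
    unfolding a_def b_def d_def w_def G_def by (simp_all flip: borel_prod)
  have J: "J (x, y) = 4/9 * (T1' x * T2' y + T2' y * T3' (x - y) + T3' (x - y) * T1' x)" for x y
  proof -
    have "a (x, y) * d (x, y) - b (x, y) * b (x, y) =
        4/9 * (T1' x * T2' y + T2' y * T3' (x - y) + T3' (x - y) * T1' x)"
      by (simp add: a_def b_def d_def field_simps)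
    moreover have "0 < 4/9 * (T1' x * T2' y + T2' y * T3' (x - y) + T3' (x - y) * T1' x)"
      using T1(2) T2(2) T3(2) by (intro mult_pos_pos add_pos_pos) auto
    ultimately show ?thesis
      by (simp only: J_def abs_of_pos)
  qed
  \<comment> \<open>The constant collects \<open>1 / (2 pi)\<close> from the normal densities,
    \<open>1/3\<close> from the arithmetic mean, and \<open>9/4\<close>, the inverse of the factor
    \<open>4/9\<close> in the determinant.\<close>
  have bound: "(f x * g y * h (x - y))\<^sup>2 \<le> 3 / (8 * pi) * (J (x, y) * w (G (x, y)))" for x y
  proof -
    define A where "A = T1 x"
    define B where "B = T2 y"
    define C where "C = T3 (x - y)"
    define A' where "A' = T1' x"
    define B' where "B' = T2' y"
    define C' where "C' = T3' (x - y)"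
    define \<sigma> where "\<sigma> = A' * B' + B' * C' + C' * A'"
    define q where "q = (2/3 * (A + C))\<^sup>2 + 2/3 * (A + C) * (2/3 * (B - C)) + (2/3 * (B - C))\<^sup>2"
    have pos': "0 < A'" "0 < B'" "0 < C'"
      using T1(2) T2(2) T3(2) by (simp_all add: A'_def B'_def C'_def)
    have nd: "std_normal_density t ^ 2 = exp (- t\<^sup>2) / (2 * pi)" for t
      by (simp add: std_normal_density_def power_mult_distrib power_divide flip: exp_of_nat_mult)
    \<comment> \<open>Cubing avoids fractional powers: it leaves only squares of \<open>f^3\<close>,
      \<open>g^3\<close>, \<open>h^3\<close>, to which the density equations apply. The squared
      derivatives regroup as the product of \<open>A' B'\<close>, \<open>B' C'\<close>,
      \<open>C' A'\<close>, whose sum \<open>\<sigma>\<close> is \<open>9/4\<close> of the Jacobian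
      determinant.\<close>
    have "((f x * g y * h (x - y))\<^sup>2) ^ 3 = (f x ^ 3 * g y ^ 3 * h (x - y) ^ 3)\<^sup>2"
      by (simp add: power_mult_distrib flip: power_mult)
    also have "\<dots> = (exp (- A\<^sup>2) / (2 * pi)) * (exp (- B\<^sup>2) / (2 * pi)) * (exp (- C\<^sup>2) / (2 * pi)) *
        (A' * B' * (B' * C') * (C' * A'))"
      unfolding T1 T2 T3 power_mult_distrib nd
      by (simp add: A_def B_def C_def A'_def B'_def C'_def power2_eq_square)
    also have "\<dots> = (1 / (2 * pi)) ^ 3 * exp (- (A\<^sup>2 + B\<^sup>2 + C\<^sup>2)) * (A' * B' * (B' * C') * (C' * A'))"
      by (simp add: power3_eq_cube exp_diff exp_minus field_simps exp_add)
    also have "\<dots> \<le> (1 / (2 * pi)) ^ 3 * exp (- (q / 2)) ^ 3 * (\<sigma> / 3) ^ 3"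
    proof (intro mult_mono mult_nonneg_nonneg)
      \<comment> \<open>Equality in \<open>3/2 * q \<le> A^2 + B^2 + C^2\<close> means
        \<open>A = B + C\<close>, which holds everywhere if the three transports are the same linear
        map; so nothing is lost for identical centred Gaussians.\<close>
      have "3/2 * q = 2/3 * (A\<^sup>2 + B\<^sup>2 + C\<^sup>2 + A*B + A*C - B*C)"
        by (simp add: q_def power2_eq_square field_simps)
      moreover have "0 \<le> (A - B - C)\<^sup>2" by simp
      hence "2 * (A*B + A*C - B*C) \<le> A\<^sup>2 + B\<^sup>2 + C\<^sup>2"
        by (simp add: power2_eq_square algebra_simps)
      ultimately have "3/2 * q \<le> A\<^sup>2 + B\<^sup>2 + C\<^sup>2" by (simp add: field_simps)
      thus "exp (- (A\<^sup>2 + B\<^sup>2 + C\<^sup>2)) \<le> exp (- (q / 2)) ^ 3"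
        by (simp flip: exp_of_nat_mult)
      show "A' * B' * (B' * C') * (C' * A') \<le> (\<sigma> / 3) ^ 3"
        using arith_geo_mean_3[of "A' * B'" "B' * C'" "C' * A'"] pos'
        by (simp add: \<sigma>_def power_divide)
    qed (use pos' in auto)
    also have "\<dots> = (1 / (2 * pi) * exp (- (q / 2)) * (\<sigma> / 3)) ^ 3"
      by (simp only: power_mult_distrib)
    finally have "(f x * g y * h (x - y))\<^sup>2 \<le> 1 / (2 * pi) * exp (- (q / 2)) * (\<sigma> / 3)"
      by (rule power_le_imp_le_base[of _ 2, unfolded Suc_numeral add_num_simps])
        (use pos' in \<open>auto simp: \<sigma>_def\<close>)
    also have "exp (- (q / 2)) = w (G (x, y))"
      by (simp only: w_def G_def q_def A_def B_def C_def prod.case fst_conv snd_conv minus_divide_left)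
    also have "\<sigma> = 9/4 * J (x, y)"
      by (simp add: J \<sigma>_def A'_def B'_def C'_def)
    finally show ?thesis by (simp add: field_simps)
  qed
  have w_nonneg: "0 \<le> w z" for z by (simp add: w_def)
  have w_int: "(\<integral>\<^sup>+z. w z \<partial>lborel) = ennreal (4 * pi / sqrt 3)"
    unfolding w_def by (rule nn_integral_gaussian_hexagonal)
  have cov: "(\<integral>\<^sup>+z. J z * w (G z) \<partial>lborel) \<le> (\<integral>\<^sup>+z. w z \<partial>lborel)"
    unfolding J_def
  proof (rule nn_integral_change_of_variables_plane_le)
    show "(G has_derivative (\<lambda>(h, k). (a z * h + b z * k, b z * h + d z * k))) (at z)" for z
    proof -
      obtain x y where z: "z = (x, y)" by fastforce
      have d1: "((\<lambda>z. T1 (fst z)) has_derivative (\<lambda>p. T1' x * fst p)) (at z)"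
        using T1(1)[of x] unfolding has_field_derivative_def z
        by (intro has_derivative_compose[of fst fst, where g = T1] has_derivative_fst) auto
      have d2: "((\<lambda>z. T2 (snd z)) has_derivative (\<lambda>p. T2' y * snd p)) (at z)"
        using T2(1)[of y] unfolding has_field_derivative_def z
        by (intro has_derivative_compose[of snd snd, where g = T2] has_derivative_snd) auto
      have d3: "((\<lambda>z. T3 (fst z - snd z)) has_derivative (\<lambda>p. T3' (x - y) * (fst p - snd p))) (at z)"
        using T3(1)[of "x - y"] unfolding has_field_derivative_def z
        by (intro has_derivative_compose[of "\<lambda>p. fst p - snd p" "\<lambda>p. fst p - snd p", where g = T3]
            has_derivative_diff has_derivative_fst has_derivative_snd) auto
      have "((\<lambda>z. (2/3 * (T1 (fst z) + T3 (fst z - snd z)), 2/3 * (T2 (snd z) - T3 (fst z - snd z))))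
        has_derivative (\<lambda>p. (2/3 * (T1' x * fst p + T3' (x - y) * (fst p - snd p)),
          2/3 * (T2' y * snd p - T3' (x - y) * (fst p - snd p))))) (at z)"
        by (intro has_derivative_Pair has_derivative_mult_right has_derivative_add has_derivative_diff d1 d2 d3)
      also have "(\<lambda>p. (2/3 * (T1' x * fst p + T3' (x - y) * (fst p - snd p)),
          2/3 * (T2' y * snd p - T3' (x - y) * (fst p - snd p)))) =
        (\<lambda>(h, k). (a z * h + b z * k, b z * h + d z * k))"
        by (auto simp: fun_eq_iff z a_def b_def d_def field_simps)
      finally show ?thesis unfolding G_def case_prod_beta' .
    qed
    show "inj G"
    proof (rule injI)
      fix z z' assume eq: "G z = G z'"
      obtain x y x' y' where z: "z = (x, y)" "z' = (x', y')" by fastforce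
      have m: "0 \<le> (T s - T t) * (s - t) \<and> (0 < (T s - T t) * (s - t) \<or> s = t)"
        if "strict_mono T" for T :: "real \<Rightarrow> real" and s t
        using strict_monoD[OF that, of s t] strict_monoD[OF that, of t s]
        by (cases s t rule: linorder_cases) (auto simp: mult_neg_neg zero_le_mult_iff)
      have e: "T1 x + T3 (x - y) = T1 x' + T3 (x' - y')" "T2 y - T3 (x - y) = T2 y' - T3 (x' - y')"
        using eq by (auto simp: G_def z)
      \<comment> \<open>Up to the factor \<open>3/2\<close>, the right side is the inner product of
        \<open>G z - G z'\<close> with \<open>z - z'\<close>. It splits into three terms, each
        nonnegative by monotonicity and zero only if the corresponding arguments agree.\<close>
      have "(T1 x - T1 x') * (x - x') + (T2 y - T2 y') * (y - y') +
          (T3 (x - y) - T3 (x' - y')) * ((x - y) - (x' - y')) =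
        ((T1 x + T3 (x - y)) - (T1 x' + T3 (x' - y'))) * (x - x') +
        ((T2 y - T3 (x - y)) - (T2 y' - T3 (x' - y'))) * (y - y')"
        by (simp add: algebra_simps)
      also have "\<dots> = 0" unfolding e by simp
      finally show "z = z'"
        using m[OF mono[OF T1(1,2)], of x x'] m[OF mono[OF T2(1,2)], of y y']
          m[OF mono[OF T3(1,2)], of "x - y" "x' - y'"] by (auto simp: z)
    qed
    show "integrable lborel w"
      by (rule integrableI_nonneg) (simp_all add: w_int w_nonneg)
  qed (simp_all add: w_nonneg)
  have "(\<integral>\<^sup>+x. \<integral>\<^sup>+y. (f x * g y * h (x - y))\<^sup>2 \<partial>lborel \<partial>lborel) \<le>
      (\<integral>\<^sup>+x. \<integral>\<^sup>+y. ennreal (3 / (8 * pi)) * (J (x, y) * w (G (x, y))) \<partial>lborel \<partial>lborel)"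
    using bound by (intro nn_integral_mono) (simp add: J_def w_def flip: ennreal_mult)
  also have "\<dots> = (\<integral>\<^sup>+z. ennreal (3 / (8 * pi)) * (J z * w (G z)) \<partial>lborel)"
    by (subst lborel_prod[symmetric], subst lborel.nn_integral_fst[symmetric])
      (auto simp: lborel_prod J_def)
  also have "\<dots> = ennreal (3 / (8 * pi)) * (\<integral>\<^sup>+z. J z * w (G z) \<partial>lborel)"
    by (rule nn_integral_cmult) (simp add: J_def)
  also have "\<dots> \<le> ennreal (3 / (8 * pi)) * ennreal (4 * pi / sqrt 3)"
    using cov unfolding w_int by (rule mult_left_mono) simp
  also have "\<dots> = ennreal (sqrt 3 / 2)"
    by (subst ennreal_mult[symmetric]) (auto simp: field_simps)
  finally show ?thesis .
qed

lemma sharp_young_continuous_scaled: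
  fixes f g h :: "real \<Rightarrow> real"
  assumes cont: "continuous_on UNIV f" "continuous_on UNIV g" "continuous_on UNIV h"
    and pos: "\<And>x. 0 < f x" "\<And>x. 0 < g x" "\<And>x. 0 < h x"
    and abc: "0 < a" "0 < b" "0 < c"
    and int: "(\<integral>\<^sup>+x. f x ^ 3 \<partial>lborel) = ennreal (a ^ 3)" "(\<integral>\<^sup>+x. g x ^ 3 \<partial>lborel) = ennreal (b ^ 3)"
      "(\<integral>\<^sup>+x. h x ^ 3 \<partial>lborel) = ennreal (c ^ 3)"
  shows "(\<integral>\<^sup>+x. \<integral>\<^sup>+y. (f x * g y * h (x - y))\<^sup>2 \<partial>lborel \<partial>lborel) \<le> ennreal (sqrt 3 / 2 * (a * b * c)\<^sup>2)"
proof -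
  have [measurable]: "f \<in> borel_measurable borel" "g \<in> borel_measurable borel" "h \<in> borel_measurable borel"
    using cont by (auto intro: borel_measurable_continuous_onI)
  have norm: "(\<integral>\<^sup>+x. (k x / r) ^ 3 \<partial>lborel) = 1"
    if "0 < r" "\<And>x. 0 < k x" "(\<integral>\<^sup>+x. k x ^ 3 \<partial>lborel) = ennreal (r ^ 3)" "k \<in> borel_measurable borel"
    for k :: "real \<Rightarrow> real" and r
  proof -
    have "(\<integral>\<^sup>+x. (k x / r) ^ 3 \<partial>lborel) = (\<integral>\<^sup>+x. ennreal (1 / r ^ 3) * (k x ^ 3) \<partial>lborel)"
      using that(1,2) by (intro nn_integral_cong) (simp add: power_divide ennreal_mult[symmetric] less_imp_le)
    also have "\<dots> = ennreal (1 / r ^ 3) * ennreal (r ^ 3)"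
      using that(4) by (simp add: nn_integral_cmult that(3))
    also have "\<dots> = 1"
      using that(1) by (subst ennreal_mult[symmetric]) auto
    finally show ?thesis .
  qed
  have "(\<integral>\<^sup>+x. \<integral>\<^sup>+y. (f x * g y * h (x - y))\<^sup>2 \<partial>lborel \<partial>lborel) =
    (\<integral>\<^sup>+x. \<integral>\<^sup>+y. ennreal ((a * b * c)\<^sup>2) * ((f x / a) * (g y / b) * (h (x - y) / c))\<^sup>2 \<partial>lborel \<partial>lborel)"
    using abc by (intro nn_integral_cong) (simp add: power_divide power_mult_distrib flip: ennreal_mult)
  also have "\<dots> = ennreal ((a * b * c)\<^sup>2) *
      (\<integral>\<^sup>+x. \<integral>\<^sup>+y. ((f x / a) * (g y / b) * (h (x - y) / c))\<^sup>2 \<partial>lborel \<partial>lborel)"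
    by (simp add: nn_integral_cmult)
  also have "\<dots> \<le> ennreal ((a * b * c)\<^sup>2) * ennreal (sqrt 3 / 2)"
    using cont pos abc int
    by (intro mult_left_mono sharp_young_continuous norm continuous_intros) auto
  also have "\<dots> = ennreal (sqrt 3 / 2 * (a * b * c)\<^sup>2)"
    by (subst ennreal_mult[symmetric]) (auto simp: mult.commute)
  finally show ?thesis .
qed

section \<open>From continuous positive functions to bounded measurable ones\<close>

text \<open>Truncating at \<open>M\<close> and multiplying by the cutoff \<open>\<tau>\<close>,
  which is 1 on \<open>[-R, R]\<close> and 0 off \<open>[-R-1, R+1]\<close>, changes no limit and
  yields a common integrable majorant; adding a vanishing multiple of the Gaussian makes the
  approximants positive.\<close>

lemma continuous_positive_approx:
  fixes \<phi> :: "real \<Rightarrow> real"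
  assumes [measurable]: "\<phi> \<in> borel_measurable borel"
    and bound: "\<And>x. 0 \<le> \<phi> x" "\<And>x. \<phi> x \<le> M" and supp: "\<And>x. R < \<bar>x\<bar> \<Longrightarrow> \<phi> x = 0"
  obtains \<Phi> where "\<And>n. continuous_on UNIV (\<Phi> n)" "\<And>n x. 0 < \<Phi> n x" "\<And>n. integrable lborel (\<Phi> n)"
    "AE x in lborel. (\<lambda>n. \<Phi> n x) \<longlonglongrightarrow> \<phi> x"
    "(\<lambda>n. LINT x|lborel. \<Phi> n x) \<longlonglongrightarrow> (LINT x|lborel. \<phi> x)"
proof -
  have M: "0 \<le> M" using bound[of 0] by simp
  have "\<phi> measurable_on UNIV"
    by (simp add: measurable_on_iff_borel_measurable lebesgue_on_UNIV_eq measurable_completion)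
  then obtain N k where N: "negligible N" and k: "\<And>n. continuous_on UNIV (k n)"
    and lim: "\<And>x. x \<notin> N \<Longrightarrow> (\<lambda>n. k n x) \<longlonglongrightarrow> \<phi> x"
    by (auto simp: measurable_on_def)
  define \<tau> where "\<tau> = (\<lambda>x. max 0 (min 1 (R + 1 - \<bar>x\<bar>)))"
  define K where "K = (\<lambda>n x. max 0 (min M (k n x)) * \<tau> x)"
  define \<Phi> where "\<Phi> = (\<lambda>n x. K n x + std_normal_density x / real (Suc n))"
  have K: "0 \<le> K n x" "K n x \<le> M * indicator {-R-1..R+1} x" for n x
  proof -
    have "max 0 (min M (k n x)) * \<tau> x \<le> M * indicator {-R-1..R+1} x"
      using M by (intro mult_mono) (auto simp: \<tau>_def indicator_def)
    thus "K n x \<le> M * indicator {-R-1..R+1} x" by (simp add: K_def)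
  qed (simp add: K_def \<tau>_def)
  have cont: "continuous_on UNIV (\<Phi> n)" for n
    unfolding \<Phi>_def K_def \<tau>_def normal_density_def by (intro continuous_intros k) auto
  hence [measurable]: "\<Phi> n \<in> borel_measurable borel" for n
    by (rule borel_measurable_continuous_onI)
  have pos: "0 < \<Phi> n x" for n x
    unfolding \<Phi>_def using K(1) normal_density_pos[of 1 0 x] by (intro add_nonneg_pos) auto
  have dom_int: "integrable lborel (\<lambda>x. M * indicator {-R-1..R+1} x + std_normal_density x)"
    by (intro Bochner_Integration.integrable_add integrable_mult_right integrable_real_indicator)
      (auto simp: emeasure_lborel_Icc_eq)
  have dom: "norm (\<Phi> n x) \<le> M * indicator {-R-1..R+1} x + std_normal_density x" for n x
  proof -
    have "std_normal_density x / real (Suc n) \<le> std_normal_density x"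
      using divide_left_mono[of 1 "real (Suc n)" "std_normal_density x"] by simp
    thus ?thesis using K(2)[of n x] pos[of n x] by (simp add: \<Phi>_def)
  qed
  have AE: "AE x in lborel. (\<lambda>n. \<Phi> n x) \<longlonglongrightarrow> \<phi> x"
  proof -
    have "AE x in lebesgue. x \<notin> N"
      using N by (intro AE_not_in) (simp add: negligible_iff_null_sets)
    hence "AE x in lborel. x \<notin> N"
      by (simp add: AE_completion_iff)
    thus ?thesis
    proof eventually_elim
      case (elim x)
      have "(\<lambda>n. \<Phi> n x) \<longlonglongrightarrow> max 0 (min M (\<phi> x)) * \<tau> x + 0"
        unfolding \<Phi>_def K_def
        by (intro tendsto_intros lim elim real_tendsto_divide_at_top[OF tendsto_const])
          (simp add: filterlim_real_sequentially filterlim_sequentially_Suc del: of_nat_Suc)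
      moreover have "max 0 (min M (\<phi> x)) * \<tau> x = \<phi> x"
      proof (cases "\<bar>x\<bar> \<le> R")
        case True
        hence "\<tau> x = 1" by (simp add: \<tau>_def)
        thus ?thesis using bound[of x] by simp
      qed (use supp M in auto)
      ultimately show ?case by simp
    qed
  qed
  show thesis
  proof (rule that[OF cont pos _ AE])
    show "integrable lborel (\<Phi> n)" for n
      by (rule Bochner_Integration.integrable_bound[OF dom_int])
        (auto intro!: AE_I2 order.trans[OF dom] simp del: real_norm_def, simp)
    show "(\<lambda>n. LINT x|lborel. \<Phi> n x) \<longlonglongrightarrow> (LINT x|lborel. \<phi> x)"
      by (rule integral_dominated_convergence[OF _ _ dom_int AE]) (use dom in auto)
  qed
qed

text \<open>Fatou's lemma, once for each integral, passes the bound to the limit. The approximants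
  have positive norms, so \<open>a\<close>, \<open>b\<close>, \<open>c\<close> may vanish in the
  limit, as norms of slices do.\<close>

lemma sharp_young_real:
  fixes f g h :: "real \<Rightarrow> real"
  assumes [measurable]: "f \<in> borel_measurable borel" "g \<in> borel_measurable borel" "h \<in> borel_measurable borel"
    and f: "\<And>x. 0 \<le> f x" "\<And>x. f x \<le> M" "\<And>x. R < \<bar>x\<bar> \<Longrightarrow> f x = 0"
    and g: "\<And>x. 0 \<le> g x" "\<And>x. g x \<le> M" "\<And>x. R < \<bar>x\<bar> \<Longrightarrow> g x = 0"
    and h: "\<And>x. 0 \<le> h x" "\<And>x. h x \<le> M" "\<And>x. R < \<bar>x\<bar> \<Longrightarrow> h x = 0"
    and abc: "0 \<le> a" "0 \<le> b" "0 \<le> c"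
    and int: "(\<integral>\<^sup>+x. f x ^ 3 \<partial>lborel) = ennreal (a ^ 3)" "(\<integral>\<^sup>+x. g x ^ 3 \<partial>lborel) = ennreal (b ^ 3)"
      "(\<integral>\<^sup>+x. h x ^ 3 \<partial>lborel) = ennreal (c ^ 3)"
  shows "(\<integral>\<^sup>+x. \<integral>\<^sup>+y. (f x * g y * h (x - y))\<^sup>2 \<partial>lborel \<partial>lborel) \<le> ennreal (sqrt 3 / 2 * (a * b * c)\<^sup>2)"
proof -
  have approx: "\<exists>(F :: nat \<Rightarrow> real \<Rightarrow> real) (r :: nat \<Rightarrow> real). (\<forall>n. continuous_on UNIV (F n) \<and> (\<forall>x. 0 < F n x) \<and> 0 < r n \<and>
      (\<integral>\<^sup>+x. ennreal (F n x ^ 3) \<partial>lborel) = ennreal (r n ^ 3)) \<and>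
      (AE x in lborel. (\<lambda>n. F n x) \<longlonglongrightarrow> (k x :: real)) \<and> r \<longlonglongrightarrow> s"
    if [measurable]: "k \<in> borel_measurable borel" and k: "\<And>x. 0 \<le> k x" "\<And>x. k x \<le> M" "\<And>x. R < \<bar>x\<bar> \<Longrightarrow> k x = 0"
      and s: "0 \<le> s" and int: "(\<integral>\<^sup>+x. k x ^ 3 \<partial>lborel) = ennreal (s ^ 3)" for k :: "real \<Rightarrow> real" and s
  proof -
    \<comment> \<open>The cube of \<open>k\<close> is approximated, not \<open>k\<close> itself: its
      integrals then converge directly, and cube roots preserve continuity, positivity and pointwise
      limits.\<close>
    obtain \<Phi> where \<Phi>: "\<And>n. continuous_on UNIV (\<Phi> n)" "\<And>n x. 0 < \<Phi> n x" "\<And>n. integrable lborel (\<Phi> n)"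
      "AE x in lborel. (\<lambda>n. \<Phi> n x) \<longlonglongrightarrow> k x ^ 3"
      "(\<lambda>n. LINT x|lborel. \<Phi> n x) \<longlonglongrightarrow> (LINT x|lborel. k x ^ 3)"
    proof (rule continuous_positive_approx[of "\<lambda>x. k x ^ 3" "M ^ 3" R])
      show "k x ^ 3 \<le> M ^ 3" for x by (intro power_mono k)
    qed (use k in auto)
    have Ik: "(LINT x|lborel. k x ^ 3) = s ^ 3"
      using int k s by (simp add: integral_eq_nn_integral)
    define r where "r = (\<lambda>n. root 3 (LINT x|lborel. \<Phi> n x))"
    have pos: "0 < (LINT x|lborel. \<Phi> n x)" for n
    proof -
      have "(LINT x|lborel. \<Phi> n x) \<noteq> 0"
      proof
        assume "(LINT x|lborel. \<Phi> n x) = 0"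
        hence "AE x in lborel. \<Phi> n x = 0"
          using \<Phi>(2,3) by (subst (asm) integral_nonneg_eq_0_iff_AE) (auto simp: less_imp_le)
        moreover have "\<Phi> n x \<noteq> 0" for x using \<Phi>(2)[of n x] by simp
        ultimately show False by (simp add: ae_filter_eq_bot_iff eventually_False)
      qed
      moreover have "0 \<le> (LINT x|lborel. \<Phi> n x)"
        using \<Phi>(2) by (intro integral_nonneg_AE) (auto simp: less_imp_le)
      ultimately show ?thesis by simp
    qed
    have F1: "continuous_on UNIV (\<lambda>x. root 3 (\<Phi> n x))" for n
        by (intro continuous_intros \<Phi>)
    have F2: "(\<integral>\<^sup>+x. root 3 (\<Phi> n x) ^ 3 \<partial>lborel) = ennreal (r n ^ 3)" for n
        using \<Phi>(2,3) pos[of n] by (simp add: r_def nn_integral_eq_integral less_imp_le)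
    have F3: "AE x in lborel. (\<lambda>n. root 3 (\<Phi> n x)) \<longlonglongrightarrow> k x"
        using \<Phi>(4)
      proof eventually_elim
        case (elim x)
        from tendsto_real_root[OF this, of 3] show ?case
          using k(1)[of x] by (simp add: real_root_power_cancel)
      qed
    have F4: "r \<longlonglongrightarrow> s"
        using tendsto_real_root[OF \<Phi>(5), of 3] s by (simp add: r_def Ik real_root_power_cancel)
    have F5: "0 < root 3 (\<Phi> n x)" "0 < r n" for n x
      using \<Phi>(2) pos by (simp_all add: r_def)
    show ?thesis
      by (rule exI[of _ "\<lambda>n x. root 3 (\<Phi> n x)"], rule exI[of _ r]) (use F1 F2 F3 F4 F5 in blast)
  qed
  obtain F :: "nat \<Rightarrow> real \<Rightarrow> real" and a' :: "nat \<Rightarrow> real" where F: "\<And>n. continuous_on UNIV (F n)" "\<And>n x. 0 < F n x" "\<And>n. 0 < a' n"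
    "\<And>n. (\<integral>\<^sup>+x. ennreal (F n x ^ 3) \<partial>lborel) = ennreal (a' n ^ 3)"
    "AE x in lborel. (\<lambda>n. F n x) \<longlonglongrightarrow> f x" "a' \<longlonglongrightarrow> a"
    using approx[OF _ f abc(1) int(1)] by auto
  obtain G :: "nat \<Rightarrow> real \<Rightarrow> real" and b' :: "nat \<Rightarrow> real" where G: "\<And>n. continuous_on UNIV (G n)" "\<And>n x. 0 < G n x" "\<And>n. 0 < b' n"
    "\<And>n. (\<integral>\<^sup>+x. ennreal (G n x ^ 3) \<partial>lborel) = ennreal (b' n ^ 3)"
    "AE x in lborel. (\<lambda>n. G n x) \<longlonglongrightarrow> g x" "b' \<longlonglongrightarrow> b"
    using approx[OF _ g abc(2) int(2)] by auto
  obtain H :: "nat \<Rightarrow> real \<Rightarrow> real" and c' :: "nat \<Rightarrow> real" where H: "\<And>n. continuous_on UNIV (H n)" "\<And>n x. 0 < H n x" "\<And>n. 0 < c' n"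
    "\<And>n. (\<integral>\<^sup>+x. ennreal (H n x ^ 3) \<partial>lborel) = ennreal (c' n ^ 3)"
    "AE x in lborel. (\<lambda>n. H n x) \<longlonglongrightarrow> h x" "c' \<longlonglongrightarrow> c"
    using approx[OF _ h abc(3) int(3)] by auto
  have [measurable]: "F n \<in> borel_measurable borel" "G n \<in> borel_measurable borel" "H n \<in> borel_measurable borel" for n
    using F(1) G(1) H(1) by (auto intro: borel_measurable_continuous_onI)
  define u where "u = (\<lambda>n x y. ennreal ((F n x * G n y * H n (x - y))\<^sup>2))"
  have [measurable]: "(\<lambda>(x, y). u n x y) \<in> borel_measurable (lborel \<Otimes>\<^sub>M lborel)" for n
    unfolding u_def by simp
  have "(\<integral>\<^sup>+x. \<integral>\<^sup>+y. (f x * g y * h (x - y))\<^sup>2 \<partial>lborel \<partial>lborel) \<le>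
      (\<integral>\<^sup>+x. \<integral>\<^sup>+y. liminf (\<lambda>n. u n x y) \<partial>lborel \<partial>lborel)"
  proof (rule nn_integral_mono_AE)
    show "AE x in lborel. (\<integral>\<^sup>+y. (f x * g y * h (x - y))\<^sup>2 \<partial>lborel) \<le>
      (\<integral>\<^sup>+y. liminf (\<lambda>n. u n x y) \<partial>lborel)"
      using F(5)
    proof eventually_elim
      case x: (elim x)
      \<comment> \<open>\<open>H n\<close> converges only outside a null set, and the affine map
        \<open>y \<mapsto> x - y\<close> pulls that set back to a null set.\<close>
      have "AE y in lborel. (\<lambda>n. H n (x + (-1) * y)) \<longlonglongrightarrow> h (x + (-1) * y)"
        using H(5) by (intro AE_borel_affine[where P = "\<lambda>z. (\<lambda>n. H n z) \<longlonglongrightarrow> h z"]) auto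
      with G(5) show ?case
      proof (intro nn_integral_mono_AE, eventually_elim)
        case (elim y)
        have "(\<lambda>n. u n x y) \<longlonglongrightarrow> ennreal ((f x * g y * h (x - y))\<^sup>2)"
          unfolding u_def using elim x by (intro tendsto_ennrealI tendsto_intros) auto
        thus ?case by (simp add: lim_imp_Liminf)
      qed
    qed
  qed
  also have "\<dots> \<le> (\<integral>\<^sup>+x. liminf (\<lambda>n. \<integral>\<^sup>+y. u n x y \<partial>lborel) \<partial>lborel)"
    by (intro nn_integral_mono nn_integral_liminf) measurable
  also have "\<dots> \<le> liminf (\<lambda>n. \<integral>\<^sup>+x. \<integral>\<^sup>+y. u n x y \<partial>lborel \<partial>lborel)"
    by (intro nn_integral_liminf) measurable
  also have "\<dots> \<le> liminf (\<lambda>n. ennreal (sqrt 3 / 2 * (a' n * b' n * c' n)\<^sup>2))"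
    unfolding u_def using F(1-4) G(1-4) H(1-4)
    by (intro Liminf_mono always_eventually allI sharp_young_continuous_scaled) auto
  also have "\<dots> = ennreal (sqrt 3 / 2 * (a * b * c)\<^sup>2)"
    by (intro lim_imp_Liminf tendsto_ennrealI tendsto_intros F(6) G(6) H(6)) simp
  finally show ?thesis .
qed

section \<open>Tensorization to finite products\<close>

interpretation lborel_product: product_sigma_finite "\<lambda>_. lborel :: real measure"
  by standard

text \<open>An induction invariant: slices inherit it with the same \<open>M\<close> and
  \<open>R\<close>, and it keeps the integrals of their cubes finite and uniformly bounded.\<close>

definition bounded_box_supported :: "'i set \<Rightarrow> real \<Rightarrow> real \<Rightarrow> (('i \<Rightarrow> real) \<Rightarrow> real) \<Rightarrow> bool" where
  "bounded_box_supported I M R f \<longleftrightarrow> f \<in> borel_measurable (PiM I (\<lambda>_. lborel)) \<and>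
    (\<forall>x. 0 \<le> f x \<and> f x \<le> M) \<and> (\<forall>x. (\<exists>i\<in>I. R < \<bar>x i\<bar>) \<longrightarrow> f x = 0)"

lemma measurable_fun_upd_PiM_const:
  "(\<lambda>x. x(i := t)) \<in> PiM I (\<lambda>_. lborel :: real measure) \<rightarrow>\<^sub>M PiM (insert i I) (\<lambda>_. lborel)"
  by (rule measurable_fun_upd[where J = I]) auto

lemma bounded_box_supported_slice:
  assumes "bounded_box_supported (insert i I) M R f" "i \<notin> I"
  shows "bounded_box_supported I M R (\<lambda>x. f (x(i := t)))"
proof -
  have "(\<lambda>x. f (x(i := t))) \<in> borel_measurable (PiM I (\<lambda>_. lborel))"
    by (rule measurable_compose[OF measurable_fun_upd_PiM_const])
      (use assms in \<open>simp add: bounded_box_supported_def\<close>)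
  moreover have "f (x(i := t)) = 0" if "j \<in> I" "R < \<bar>x j\<bar>" for x j
  proof -
    have "R < \<bar>(x(i := t)) j\<bar>" using that assms(2) by auto
    with that(1) assms(1) show ?thesis unfolding bounded_box_supported_def by blast
  qed
  ultimately show ?thesis using assms(1) by (auto simp: bounded_box_supported_def)
qed

text \<open>\<open>k t\<close> is the \<open>L^3\<close> norm of the slice at \<open>t\<close>, the
  function fed to the one-dimensional inequality. The bound \<open>V\<close>, the cube root of
  \<open>M^3\<close> times the volume of the box, does not depend on \<open>f\<close>, so that three
  functions can share it.\<close>

lemma slice_cube_roots:
  fixes I :: "'i set"
  assumes "finite I" "i \<notin> I"
  obtains V where "\<And>f a. bounded_box_supported (insert i I) M R f \<Longrightarrow>
      (\<integral>\<^sup>+x. f x ^ 3 \<partial>PiM (insert i I) (\<lambda>_. lborel)) = ennreal (a ^ 3) \<Longrightarrow>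
      \<exists>k. k \<in> borel_measurable borel \<and> (\<forall>t. 0 \<le> k t \<and> k t \<le> V) \<and> (\<forall>t. R < \<bar>t\<bar> \<longrightarrow> k t = 0) \<and>
        (\<forall>t. (\<integral>\<^sup>+x. f (x(i := t)) ^ 3 \<partial>PiM I (\<lambda>_. lborel)) = ennreal (k t ^ 3)) \<and>
        (\<integral>\<^sup>+t. k t ^ 3 \<partial>lborel) = ennreal (a ^ 3)"
proof -
  let ?P = "\<lambda>I. PiM I (\<lambda>_. lborel :: real measure)"
  define B where "B = ennreal (M ^ 3) * emeasure (?P I) (PiE I (\<lambda>_. {-R..R}))"
  have "emeasure (?P I) (PiE I (\<lambda>_. {-R..R})) < \<infinity>"
    using assms(1) by (subst lborel_product.emeasure_PiM) (auto simp: emeasure_lborel_Icc_eq power_less_top_ennreal)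
  hence B: "B < \<infinity>"
    by (simp add: B_def ennreal_mult_less_top)
  interpret PI: sigma_finite_measure "?P I"
    using assms(1) by (rule lborel_product.sigma_finite)
  have [measurable]: "PiE I (\<lambda>_. {-R..R}) \<in> sets (?P I)"
    using assms(1) by (intro sets_PiM_I_finite) auto
  show thesis
  proof (rule that[of "root 3 (enn2real B)"])
    fix f :: "('i \<Rightarrow> real) \<Rightarrow> real" and a
    assume f: "bounded_box_supported (insert i I) M R f"
      and int: "(\<integral>\<^sup>+x. f x ^ 3 \<partial>?P (insert i I)) = ennreal (a ^ 3)"
    have [measurable]: "f \<in> borel_measurable (?P (insert i I))"
      using f by (simp add: bounded_box_supported_def)
    define F where "F = (\<lambda>t. \<integral>\<^sup>+x. f (x(i := t)) ^ 3 \<partial>?P I)"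
    define k where "k = (\<lambda>t. root 3 (enn2real (F t)))"
    have [measurable]: "F \<in> borel_measurable borel"
      unfolding F_def by (intro PI.borel_measurable_nn_integral) measurable
    have FB: "F t \<le> B" for t
    proof -
      note ft = bounded_box_supported_slice[OF f assms(2), of t]
      have "F t \<le> (\<integral>\<^sup>+x. ennreal (M ^ 3) * indicator (PiE I (\<lambda>_. {-R..R})) x \<partial>?P I)"
        unfolding F_def
      proof (rule nn_integral_mono)
        fix x assume x: "x \<in> space (?P I)"
        show "ennreal (f (x(i := t)) ^ 3) \<le> ennreal (M ^ 3) * indicator (PiE I (\<lambda>_. {-R..R})) x"
        proof (cases "\<exists>j\<in>I. R < \<bar>x j\<bar>")
          case True
          thus ?thesis using ft by (auto simp: bounded_box_supported_def)
        next
          case False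
          hence "x \<in> PiE I (\<lambda>_. {-R..R})"
            using x by (auto simp: space_PiM PiE_iff abs_le_iff not_less)
          moreover have "f (x(i := t)) ^ 3 \<le> M ^ 3"
            using f by (intro power_mono) (auto simp: bounded_box_supported_def)
          ultimately show ?thesis by (simp add: ennreal_leI)
        qed
      qed
      also have "\<dots> = B" by (simp add: B_def nn_integral_cmult)
      finally show ?thesis .
    qed
    have k3: "F t = ennreal (k t ^ 3)" for t
      using le_less_trans[OF FB[of t] B] by (simp add: k_def)
    show "\<exists>k. k \<in> borel_measurable borel \<and> (\<forall>t. 0 \<le> k t \<and> k t \<le> root 3 (enn2real B)) \<and>
        (\<forall>t. R < \<bar>t\<bar> \<longrightarrow> k t = 0) \<and>
        (\<forall>t. (\<integral>\<^sup>+x. f (x(i := t)) ^ 3 \<partial>?P I) = ennreal (k t ^ 3)) \<and>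
        (\<integral>\<^sup>+t. k t ^ 3 \<partial>lborel) = ennreal (a ^ 3)"
    proof (intro exI[of _ k] conjI allI impI)
      show "k \<in> borel_measurable borel" unfolding k_def by measurable
      show "0 \<le> k t" "k t \<le> root 3 (enn2real B)" for t
        using FB[of t] B by (auto simp: k_def intro: enn2real_mono)
      show "k t = 0" if "R < \<bar>t\<bar>" for t
      proof -
        have "f (x(i := t)) = 0" for x
        proof -
          have "R < \<bar>(x(i := t)) i\<bar>" using that by simp
          thus ?thesis using f unfolding bounded_box_supported_def by blast
        qed
        thus ?thesis by (simp add: k_def F_def)
      qed
      show "(\<integral>\<^sup>+x. f (x(i := t)) ^ 3 \<partial>?P I) = ennreal (k t ^ 3)" for t
        using k3[of t] by (simp add: F_def)
      have "(\<integral>\<^sup>+t. k t ^ 3 \<partial>lborel) = (\<integral>\<^sup>+t. \<integral>\<^sup>+x. f (x(i := t)) ^ 3 \<partial>?P I \<partial>lborel)"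
        by (intro nn_integral_cong) (simp add: k3[symmetric] F_def)
      also have "\<dots> = (\<integral>\<^sup>+x. f x ^ 3 \<partial>?P (insert i I))"
        using assms by (subst lborel_product.product_nn_integral_insert_rev) auto
      finally show "(\<integral>\<^sup>+t. k t ^ 3 \<partial>lborel) = ennreal (a ^ 3)"
        using int by simp
    qed
  qed
qed

text \<open>The constants multiply because, with coordinate \<open>i\<close> frozen at
  \<open>s\<close> and \<open>t\<close>, the induction hypothesis bounds the inner integral by a
  constant times \<open>(A s * B t * D (s - t))^2\<close>, where \<open>A\<close>, \<open>B\<close>,
  \<open>D\<close> are norms of slices. This is again a Young integrand, now on the line.\<close>

lemma sharp_young_PiM:
  fixes f g h :: "('i \<Rightarrow> real) \<Rightarrow> real"
  assumes "finite I"
    and "bounded_box_supported I M R f" "bounded_box_supported I M R g" "bounded_box_supported I M R h"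
    and "0 \<le> a" "0 \<le> b" "0 \<le> c"
    and "(\<integral>\<^sup>+x. f x ^ 3 \<partial>PiM I (\<lambda>_. lborel)) = ennreal (a ^ 3)"
      "(\<integral>\<^sup>+x. g x ^ 3 \<partial>PiM I (\<lambda>_. lborel)) = ennreal (b ^ 3)"
      "(\<integral>\<^sup>+x. h x ^ 3 \<partial>PiM I (\<lambda>_. lborel)) = ennreal (c ^ 3)"
  shows "(\<integral>\<^sup>+x. \<integral>\<^sup>+y. (f x * g y * h (\<lambda>i\<in>I. x i - y i))\<^sup>2 \<partial>PiM I (\<lambda>_. lborel) \<partial>PiM I (\<lambda>_. lborel))
    \<le> ennreal ((sqrt 3 / 2) ^ card I * (a * b * c)\<^sup>2)"
  using assms
proof (induction I arbitrary: f g h a b c rule: finite_induct)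
  case empty
  \<comment> \<open>The empty product is a single point of mass 1, so each function equals its norm
    there.\<close>
  have eq: "k (\<lambda>_. undefined) = r" if "bounded_box_supported {} M R k" "0 \<le> r"
    "(\<integral>\<^sup>+x. k x ^ 3 \<partial>PiM {} (\<lambda>_. lborel)) = ennreal (r ^ 3)" for k :: "('i \<Rightarrow> real) \<Rightarrow> real" and r
  proof -
    have "0 \<le> k (\<lambda>_. undefined)" using that(1) by (simp add: bounded_box_supported_def)
    moreover have "ennreal (k (\<lambda>_. undefined) ^ 3) = ennreal (r ^ 3)"
      using that(3) by (simp add: lborel_product.nn_integral_empty)
    ultimately show ?thesis using that(2) by (simp add: power_eq_iff_eq_base)
  qed
  have "(\<lambda>i\<in>{}. x i - y i) = (\<lambda>_. undefined)" for x y :: "'i \<Rightarrow> real"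
    by (simp add: fun_eq_iff)
  thus ?case
    using eq[of f a] eq[of g b] eq[of h c] empty by (simp add: lborel_product.nn_integral_empty)
next
  case (insert i I)
  let ?P = "\<lambda>I. PiM I (\<lambda>_. lborel :: real measure)"
  let ?C = "sqrt 3 / 2 :: real"
  have fin: "finite (insert i I)" using insert.hyps by simp
  interpret PI: sigma_finite_measure "?P I"
    using insert.hyps(1) by (rule lborel_product.sigma_finite)
  interpret PJ: sigma_finite_measure "?P (insert i I)"
    using fin by (rule lborel_product.sigma_finite)
  interpret pair_sigma_finite "?P I" "lborel :: real measure"
    by standard
  have [measurable]: "f \<in> borel_measurable (?P (insert i I))" "g \<in> borel_measurable (?P (insert i I))"
    "h \<in> borel_measurable (?P (insert i I))"
    using insert.prems by (simp_all add: bounded_box_supported_def)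
  obtain V where V: "\<And>f a. bounded_box_supported (insert i I) M R f \<Longrightarrow>
      (\<integral>\<^sup>+x. f x ^ 3 \<partial>?P (insert i I)) = ennreal (a ^ 3) \<Longrightarrow>
      \<exists>k. k \<in> borel_measurable borel \<and> (\<forall>t. 0 \<le> k t \<and> k t \<le> V) \<and> (\<forall>t. R < \<bar>t\<bar> \<longrightarrow> k t = 0) \<and>
        (\<forall>t. (\<integral>\<^sup>+x. f (x(i := t)) ^ 3 \<partial>?P I) = ennreal (k t ^ 3)) \<and>
        (\<integral>\<^sup>+t. k t ^ 3 \<partial>lborel) = ennreal (a ^ 3)"
    using slice_cube_roots[OF insert.hyps(1,2), of M R] by blast
  obtain A where A: "A \<in> borel_measurable borel" "\<And>t. 0 \<le> A t" "\<And>t. A t \<le> V" "\<And>t. R < \<bar>t\<bar> \<Longrightarrow> A t = 0"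
    "\<And>t. (\<integral>\<^sup>+x. f (x(i := t)) ^ 3 \<partial>?P I) = ennreal (A t ^ 3)" "(\<integral>\<^sup>+t. A t ^ 3 \<partial>lborel) = ennreal (a ^ 3)"
    using V[OF insert.prems(1,7)] by blast
  obtain B where B: "B \<in> borel_measurable borel" "\<And>t. 0 \<le> B t" "\<And>t. B t \<le> V" "\<And>t. R < \<bar>t\<bar> \<Longrightarrow> B t = 0"
    "\<And>t. (\<integral>\<^sup>+x. g (x(i := t)) ^ 3 \<partial>?P I) = ennreal (B t ^ 3)" "(\<integral>\<^sup>+t. B t ^ 3 \<partial>lborel) = ennreal (b ^ 3)"
    using V[OF insert.prems(2,8)] by blast
  obtain D where D: "D \<in> borel_measurable borel" "\<And>t. 0 \<le> D t" "\<And>t. D t \<le> V" "\<And>t. R < \<bar>t\<bar> \<Longrightarrow> D t = 0"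
    "\<And>t. (\<integral>\<^sup>+x. h (x(i := t)) ^ 3 \<partial>?P I) = ennreal (D t ^ 3)" "(\<integral>\<^sup>+t. D t ^ 3 \<partial>lborel) = ennreal (c ^ 3)"
    using V[OF insert.prems(3,9)] by blast
  define \<Psi> where "\<Psi> = (\<lambda>x y. ennreal ((f x * g y * h (\<lambda>j\<in>insert i I. x j - y j))\<^sup>2))"
  have \<Psi>[measurable]: "(\<lambda>(x, y). \<Psi> x y) \<in> borel_measurable (?P (insert i I) \<Otimes>\<^sub>M ?P (insert i I))"
    unfolding \<Psi>_def by measurable
  \<comment> \<open>Slicing commutes with differences: the third function is sliced at
    \<open>s - t\<close>.\<close>
  have upd: "(\<lambda>j\<in>insert i I. (x(i := s)) j - (y(i := t)) j) = (\<lambda>j\<in>I. x j - y j)(i := s - t)"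
    for x y :: "'i \<Rightarrow> real" and s t
    using insert.hyps(2) by (auto simp: fun_eq_iff restrict_def)
  have "(\<integral>\<^sup>+x. \<integral>\<^sup>+y. \<Psi> x y \<partial>?P (insert i I) \<partial>?P (insert i I)) =
      (\<integral>\<^sup>+s. \<integral>\<^sup>+x. \<integral>\<^sup>+y. \<Psi> (x(i := s)) y \<partial>?P (insert i I) \<partial>?P I \<partial>lborel)"
    using insert.hyps by (intro lborel_product.product_nn_integral_insert_rev) measurable
  also have "\<dots> = (\<integral>\<^sup>+s. \<integral>\<^sup>+x. \<integral>\<^sup>+t. \<integral>\<^sup>+y. \<Psi> (x(i := s)) (y(i := t)) \<partial>?P I \<partial>lborel \<partial>?P I \<partial>lborel)"
  proof (intro nn_integral_cong lborel_product.product_nn_integral_insert_rev insert.hyps)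
    fix s x assume "x \<in> space (?P I)"
    hence "x(i := s) \<in> space (?P (insert i I))"
      by (rule measurable_space[OF measurable_fun_upd_PiM_const])
    thus "\<Psi> (x(i := s)) \<in> borel_measurable (?P (insert i I))"
      using measurable_Pair2[OF \<Psi>] by simp
  qed
  also have "\<dots> = (\<integral>\<^sup>+s. \<integral>\<^sup>+t. \<integral>\<^sup>+x. \<integral>\<^sup>+y. \<Psi> (x(i := s)) (y(i := t)) \<partial>?P I \<partial>?P I \<partial>lborel \<partial>lborel)"
    by (intro nn_integral_cong Fubini'[symmetric]) measurable
  also have "\<dots> \<le> (\<integral>\<^sup>+s. \<integral>\<^sup>+t. ennreal (?C ^ card I) * ennreal ((A s * B t * D (s - t))\<^sup>2) \<partial>lborel \<partial>lborel)"
  proof (intro nn_integral_mono)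
    fix s t
    have "(\<integral>\<^sup>+x. \<integral>\<^sup>+y. \<Psi> (x(i := s)) (y(i := t)) \<partial>?P I \<partial>?P I) \<le>
        ennreal (?C ^ card I * (A s * B t * D (s - t))\<^sup>2)"
      unfolding \<Psi>_def upd
      by (rule insert.IH[OF bounded_box_supported_slice[OF insert.prems(1) insert.hyps(2)]
            bounded_box_supported_slice[OF insert.prems(2) insert.hyps(2)]
            bounded_box_supported_slice[OF insert.prems(3) insert.hyps(2)]
            A(2) B(2) D(2) A(5) B(5) D(5)])
    thus "(\<integral>\<^sup>+x. \<integral>\<^sup>+y. \<Psi> (x(i := s)) (y(i := t)) \<partial>?P I \<partial>?P I) \<le>
        ennreal (?C ^ card I) * ennreal ((A s * B t * D (s - t))\<^sup>2)"
      by (simp add: ennreal_mult)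
  qed
  also have "\<dots> = ennreal (?C ^ card I) * (\<integral>\<^sup>+s. \<integral>\<^sup>+t. ennreal ((A s * B t * D (s - t))\<^sup>2) \<partial>lborel \<partial>lborel)"
    using A(1) B(1) D(1) by (simp add: nn_integral_cmult)
  also have "\<dots> \<le> ennreal (?C ^ card I) * ennreal (?C * (a * b * c)\<^sup>2)"
    using A B D insert.prems(4-6) by (intro mult_left_mono sharp_young_real[where M = V and R = R]) auto
  also have "\<dots> = ennreal (?C ^ card (insert i I) * (a * b * c)\<^sup>2)"
    using insert.hyps by (subst ennreal_mult[symmetric]) (auto simp: mult_ac)
  finally show ?case by (simp only: \<Psi>_def)
qed

section \<open>Greedy selection and the convex body\<close>

text \<open>Discard the points of more than twice the average degree, then choose greedily.\<close>
lemma exists_pairwise_unrelated_points: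
  assumes "sigma_finite_measure M" and S[measurable]: "S \<in> sets M"
    and A: "emeasure M S = ennreal A" "0 < A"
    and E[measurable]: "Measurable.pred (M \<Otimes>\<^sub>M M) (\<lambda>(x, y). E x y)"
    and sym: "\<And>x y. E x y \<Longrightarrow> E y x"
    and avg: "(\<integral>\<^sup>+x. emeasure M {y \<in> S. E x y} * indicator S x \<partial>M) \<le> ennreal (\<epsilon> * A\<^sup>2)"
    and \<epsilon>: "0 < \<epsilon>" "(real n - 1) * (4 * \<epsilon>) < 1"
  shows "\<exists>xs. (\<forall>i<n. xs i \<in> S) \<and> (\<forall>i<n. \<forall>j<n. i \<noteq> j \<longrightarrow> \<not> E (xs i) (xs j))"
proof -
  interpret sigma_finite_measure M by fact
  have SM: "S \<subseteq> space M" using S by (rule sets.sets_into_space)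
  have Ex[measurable]: "{y \<in> S. E x y} \<in> sets M" if "x \<in> space M" for x
  proof -
    have "{y \<in> space M. E x y} \<in> sets M"
      using measurable_Pair2[OF E that] by (simp add: pred_def)
    moreover have "{y \<in> S. E x y} = S \<inter> {y \<in> space M. E x y}" using SM by auto
    ultimately show ?thesis using S by simp
  qed
  define deg where "deg = (\<lambda>x. \<integral>\<^sup>+y. indicator {(x, y). y \<in> S \<and> E x y} (x, y) \<partial>M)"
  have "{(x, y). y \<in> S \<and> E x y} \<inter> space (M \<Otimes>\<^sub>M M) =
    {z \<in> space (M \<Otimes>\<^sub>M M). snd z \<in> S \<and> (case z of (x, y) \<Rightarrow> E x y)}" by auto
  also have "\<dots> \<in> sets (M \<Otimes>\<^sub>M M)" by measurable
  finally have "(\<lambda>z. indicator {(x, y). y \<in> S \<and> E x y} z :: ennreal) \<in> borel_measurable (M \<Otimes>\<^sub>M M)"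
    by (simp add: borel_measurable_indicator_iff)
  hence [measurable]: "deg \<in> borel_measurable M"
    unfolding deg_def by (intro borel_measurable_nn_integral) (simp add: case_prod_beta')
  have deg: "deg x = emeasure M {y \<in> S. E x y}" if "x \<in> space M" for x
  proof -
    have "deg x = (\<integral>\<^sup>+y. indicator {y \<in> S. E x y} y \<partial>M)"
      unfolding deg_def by (intro nn_integral_cong) (auto simp: indicator_def)
    thus ?thesis using Ex[OF that] by simp
  qed
  \<comment> \<open>The average degree is at most \<open>\<epsilon> * A\<close>; by Markov's
    inequality the points of at least twice that degree fill at most half of
    \<open>S\<close>.\<close>
  define G where "G = {x \<in> S. deg x < ennreal (2 * \<epsilon> * A)}"
  have [measurable]: "G \<in> sets M"
  proof -
    have "G = S \<inter> {x \<in> space M. deg x < ennreal (2 * \<epsilon> * A)}" using SM by (auto simp: G_def)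
    thus ?thesis by simp
  qed
  have "emeasure M {x \<in> S. 1 \<le> ennreal (1 / (2 * \<epsilon> * A)) * deg x} \<le>
      ennreal (1 / (2 * \<epsilon> * A)) * (\<integral>\<^sup>+x. deg x * indicator S x \<partial>M)"
    by (rule nn_integral_Markov_inequality) auto
  also have "(\<integral>\<^sup>+x. deg x * indicator S x \<partial>M) \<le> ennreal (\<epsilon> * A\<^sup>2)"
    using avg SM by (subst nn_integral_cong[where v = "\<lambda>x. emeasure M {y \<in> S. E x y} * indicator S x"])
      (auto simp: deg indicator_def)
  also have "ennreal (1 / (2 * \<epsilon> * A)) * ennreal (\<epsilon> * A\<^sup>2) = ennreal (A / 2)"
    using A(2) \<epsilon>(1) by (subst ennreal_mult[symmetric]) (auto simp: field_simps power2_eq_square)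
  finally have markov: "emeasure M {x \<in> S. 1 \<le> ennreal (1 / (2 * \<epsilon> * A)) * deg x} \<le> ennreal (A / 2)"
    by (simp add: mult_left_mono)
  have "S - G \<subseteq> {x \<in> S. 1 \<le> ennreal (1 / (2 * \<epsilon> * A)) * deg x}"
  proof
    fix x assume "x \<in> S - G"
    hence x: "x \<in> S" "ennreal (2 * \<epsilon> * A) \<le> deg x" by (auto simp: G_def)
    have "1 = ennreal (1 / (2 * \<epsilon> * A)) * ennreal (2 * \<epsilon> * A)"
      using A(2) \<epsilon>(1) by (subst ennreal_mult[symmetric]) auto
    also have "\<dots> \<le> ennreal (1 / (2 * \<epsilon> * A)) * deg x"
      using x(2) by (rule mult_left_mono) simp
    finally show "x \<in> {x \<in> S. 1 \<le> ennreal (1 / (2 * \<epsilon> * A)) * deg x}" using x(1) by simp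
  qed
  hence "emeasure M (S - G) \<le> emeasure M {x \<in> S. 1 \<le> ennreal (1 / (2 * \<epsilon> * A)) * deg x}"
    by (rule emeasure_mono) measurable
  with markov have SG: "emeasure M (S - G) \<le> ennreal (A / 2)" by simp
  \<comment> \<open>Each chosen point rules out measure at most \<open>2 * \<epsilon> * A\<close> of
    the at least \<open>A / 2\<close> in \<open>G\<close>. The last of \<open>m\<close> points only
    has to avoid \<open>m - 1\<close> others, hence \<open>real m - 1\<close>.\<close>
  have "\<exists>xs. (\<forall>i<m. xs i \<in> G) \<and> (\<forall>i<m. \<forall>j<m. i \<noteq> j \<longrightarrow> \<not> E (xs i) (xs j))"
    if "(real m - 1) * (4 * \<epsilon>) < 1" for m
    using that
  proof (induction m)
    case (Suc m)
    have "(real m - 1) * (4 * \<epsilon>) \<le> (real (Suc m) - 1) * (4 * \<epsilon>)"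
      using \<epsilon>(1) by (intro mult_right_mono) auto
    with Suc obtain xs where xs: "\<forall>i<m. xs i \<in> G" "\<forall>i<m. \<forall>j<m. i \<noteq> j \<longrightarrow> \<not> E (xs i) (xs j)"
      by fastforce
    have xsM: "xs i \<in> space M" if "i < m" for i
      using xs(1) that SM by (auto simp: G_def)
    have [measurable]: "(\<Union>i<m. {y \<in> S. E (xs i) y}) \<in> sets M"
      by (intro sets.finite_UN Ex xsM) auto
    have "\<exists>y\<in>G. \<forall>i<m. \<not> E (xs i) y"
    proof (rule ccontr)
      assume "\<not> ?thesis"
      hence "S \<subseteq> (S - G) \<union> (\<Union>i<m. {y \<in> S. E (xs i) y})" by (auto simp: G_def)
      hence "emeasure M S \<le> emeasure M ((S - G) \<union> (\<Union>i<m. {y \<in> S. E (xs i) y}))"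
        by (rule emeasure_mono) measurable
      also have "\<dots> \<le> emeasure M (S - G) + emeasure M (\<Union>i<m. {y \<in> S. E (xs i) y})"
        by (rule emeasure_subadditive) measurable
      also have "\<dots> \<le> ennreal (A / 2) + (\<Sum>i<m. emeasure M {y \<in> S. E (xs i) y})"
        using SG by (intro add_mono emeasure_subadditive_finite) (auto intro: Ex xsM)
      also have "\<dots> \<le> ennreal (A / 2) + (\<Sum>i<m. ennreal (2 * \<epsilon> * A))"
        using xs(1) xsM by (intro add_left_mono sum_mono) (auto simp: G_def deg[symmetric] less_imp_le)
      also have "\<dots> = ennreal (A / 2 + real m * (2 * \<epsilon> * A))"
        using A(2) \<epsilon>(1) by (simp add: ennreal_plus ennreal_mult ennreal_of_nat_eq_real_of_nat)
      finally have "ennreal A \<le> ennreal (A / 2 + real m * (2 * \<epsilon> * A))"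
        by (simp only: A(1))
      hence "A \<le> A / 2 + real m * (2 * \<epsilon> * A)"
        by (rule ennreal_le_iff[THEN iffD1, rotated]) (use A(2) \<epsilon>(1) in auto)
      hence "A * 1 \<le> A * (real m * (4 * \<epsilon>))" by (simp add: field_simps)
      hence "1 \<le> real m * (4 * \<epsilon>)" using A(2) by (simp only: mult_le_cancel_left_pos)
      thus False using Suc.prems by simp
    qed
    then obtain y where y: "y \<in> G" "\<And>i. i < m \<Longrightarrow> \<not> E (xs i) y" by auto
    have "\<not> E y (xs i)" if "i < m" for i using y(2)[OF that] sym by blast
    with y xs show ?case
      by (intro exI[of _ "xs(m := y)"]) (auto simp: less_Suc_eq)
  qed simp
  from this[OF \<epsilon>(2)] show ?thesis by (auto simp: G_def)
qed

lemma difference_avoiding_points: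
  fixes K :: "(nat \<Rightarrow> real) set"
  assumes K: "convex_body d K" and p: "p \<in> int_d d K"
    and n: "(real n - 1) * (8 * (sqrt 3 / 2) ^ d) < 1"
  shows "\<exists>xs. (\<forall>i<n. xs i \<in> Rd d \<and> (\<lambda>k. xs i k + p k) \<in> K) \<and>
    (\<forall>i<n. \<forall>j<n. i \<noteq> j \<longrightarrow> (\<lambda>k. xs i k - xs j k + p k) \<notin> K)"
proof -
  let ?I = "{..<d}"
  let ?P = "PiM ?I (\<lambda>_. lborel :: real measure)"
  interpret P: sigma_finite_measure ?P
    by (rule lborel_product.sigma_finite) simp
  have KR: "K \<subseteq> Rd d" and compact: "compact K" using K by (auto simp: convex_body_def)
  obtain e where pR: "p \<in> Rd d" and e: "0 < e" "{x \<in> Rd d. dist_d d p x < e} \<subseteq> K"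
    using p by (auto simp: int_d_def)
  \<comment> \<open>Elements of the product space are \<open>undefined\<close> from index
    \<open>d\<close> on; \<open>\<iota>\<close> replaces this by zeros, and \<open>shift\<close>
    then moves the origin to \<open>p\<close>. Thus \<open>S\<close> is \<open>K - p\<close> in
    product coordinates.\<close>
  define \<iota> where "\<iota> = (\<lambda>x::nat \<Rightarrow> real. \<lambda>k. if k < d then x k else 0)"
  define shift where "shift = (\<lambda>x k. \<iota> x k + p k)"
  define f where "f = (\<lambda>x. indicator K (shift x) :: real)"
  have [measurable]: "K \<in> sets borel"
    using compact by (intro borel_closed compact_imp_closed)
  have [measurable]: "shift \<in> ?P \<rightarrow>\<^sub>M borel"
  proof (rule measurable_coordinatewise_then_product)
    show "(\<lambda>x. shift x k) \<in> borel_measurable ?P" for k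
      by (cases "k < d") (auto simp: shift_def \<iota>_def)
  qed
  have [measurable]: "f \<in> borel_measurable ?P"
    unfolding f_def by measurable
  define S where "S = {x \<in> space ?P. shift x \<in> K}"
  have [measurable]: "S \<in> sets ?P" unfolding S_def by measurable
  obtain R where R: "\<And>x k. x \<in> K \<Longrightarrow> k < d \<Longrightarrow> \<bar>x k - p k\<bar> \<le> R"
  proof -
    have "\<exists>r. \<forall>x\<in>K. \<bar>x k - p k\<bar> \<le> r" for k
    proof -
      have "compact ((\<lambda>x. x k - p k) ` K)"
        by (intro compact_continuous_image compact continuous_intros
            continuous_on_product_then_coordinatewise[OF continuous_on_id])
      thus ?thesis by (auto dest!: compact_imp_bounded simp: bounded_iff)
    qed
    then obtain r where r: "\<And>k x. x \<in> K \<Longrightarrow> \<bar>x k - p k\<bar> \<le> r k" by metis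
    have "\<bar>x k - p k\<bar> \<le> (\<Sum>k<d. \<bar>r k\<bar>)" if "x \<in> K" "k < d" for x k
      using r[OF that(1), of k] member_le_sum[of k "{..<d}" "\<lambda>k. \<bar>r k\<bar>"] that(2) by auto
    thus thesis by (rule that)
  qed
  have supp: "f x = 0" if "k < d" "R < \<bar>x k\<bar>" for x k
    using R[of "shift x" k] that by (auto simp: f_def indicator_def shift_def \<iota>_def)
  have bbs: "bounded_box_supported ?I 1 R f"
    unfolding bounded_box_supported_def using supp by (auto simp: f_def)
  have "emeasure ?P S \<le> emeasure ?P (PiE ?I (\<lambda>_. {-R..R}))"
  proof (rule emeasure_mono)
    show "S \<subseteq> PiE ?I (\<lambda>_. {-R..R})"
    proof
      fix x assume x: "x \<in> S"
      have "\<bar>x k\<bar> \<le> R" if "k < d" for k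
        using R[of "shift x" k] x that by (auto simp: S_def shift_def \<iota>_def)
      thus "x \<in> PiE ?I (\<lambda>_. {-R..R})"
        using x by (auto simp: S_def space_PiM PiE_iff abs_le_iff minus_le_iff)
    qed
  qed (intro sets_PiM_I_finite, auto)
  also have "\<dots> < \<infinity>"
    by (subst lborel_product.emeasure_PiM) (auto simp: emeasure_lborel_Icc_eq power_less_top_ennreal)
  finally have fin: "emeasure ?P S < \<infinity>" .
  have pos: "0 < emeasure ?P S"
  proof -
    \<comment> \<open>A cube around \<open>p\<close> inside the ball: the Euclidean distance is at
      most the sum of the coordinate differences, hence at most \<open>d * r < e\<close>.\<close>
    define r where "r = e / (real d + 1)"
    have r: "0 < r" using e(1) by (simp add: r_def)
    have "0 < ennreal ((2 * r) ^ d)" using r by simp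
    also have "\<dots> = emeasure ?P (PiE ?I (\<lambda>_. {-r..r}))"
      using r by (subst lborel_product.emeasure_PiM) (auto simp: ennreal_power)
    also have "\<dots> \<le> emeasure ?P S"
    proof (rule emeasure_mono)
      show "PiE ?I (\<lambda>_. {-r..r}) \<subseteq> S"
      proof
        fix x assume x: "x \<in> PiE ?I (\<lambda>_. {-r..r})"
        have "dist_d d p (shift x) \<le> (\<Sum>k<d. \<bar>p k - shift x k\<bar>)"
          unfolding dist_d_def using L2_set_le_sum_abs[of "\<lambda>k. p k - shift x k" "{..<d}"]
          by (simp add: L2_set_def)
        also have "\<dots> \<le> (\<Sum>k<d. r)"
          using x by (intro sum_mono) (auto simp: shift_def \<iota>_def PiE_iff abs_le_iff minus_le_iff)
        also have "\<dots> < e" using e(1) by (simp add: r_def field_simps)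
        finally have "dist_d d p (shift x) < e" .
        moreover have "shift x \<in> Rd d" using pR by (auto simp: Rd_def shift_def \<iota>_def)
        ultimately have "shift x \<in> K" using e(2) by auto
        thus "x \<in> S" using x by (auto simp: S_def space_PiM PiE_iff)
      qed
    qed simp
    finally show ?thesis .
  qed
  define A where "A = measure ?P S"
  have A: "emeasure ?P S = ennreal A" "0 < A"
    using fin emeasure_eq_ennreal_measure[of ?P S] pos
    by (simp_all add: A_def measure_def enn2real_positive_iff)
  define a where "a = root 3 A"
  have a: "0 \<le> a" "a ^ 3 = A" using A(2) by (auto simp: a_def)
  have fS: "f x = indicator S x" if "x \<in> space ?P" for x
    using that by (auto simp: f_def S_def indicator_def)
  have f_int: "(\<integral>\<^sup>+x. f x ^ 3 \<partial>?P) = ennreal (a ^ 3)"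
  proof -
    have "(\<integral>\<^sup>+x. f x ^ 3 \<partial>?P) = (\<integral>\<^sup>+x. indicator S x \<partial>?P)"
      by (intro nn_integral_cong) (auto simp: fS indicator_def)
    thus ?thesis using A(1) a(2) by simp
  qed
  define D where "D = (\<lambda>x y. (\<lambda>k\<in>?I. x k - y k) \<in> S)"
  have [measurable]: "Measurable.pred (?P \<Otimes>\<^sub>M ?P) (\<lambda>z. D (fst z) (snd z))"
    unfolding D_def by measurable
  have [measurable]: "Measurable.pred (?P \<Otimes>\<^sub>M ?P) (\<lambda>z. D (snd z) (fst z))"
    unfolding D_def by measurable
  define q where "q = (sqrt 3 / 2 :: real) ^ d"
  have young: "(\<integral>\<^sup>+x. \<integral>\<^sup>+y. indicator S x * indicator S y * (if D x y then 1 else 0) \<partial>?P \<partial>?P) \<le> ennreal (q * A\<^sup>2)"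
  proof -
    \<comment> \<open>An indicator equals its own square and cube, so the inequality for three
      copies of \<open>f\<close> speaks of volumes only.\<close>
    have "(\<integral>\<^sup>+x. \<integral>\<^sup>+y. indicator S x * indicator S y * (if D x y then 1 else 0) \<partial>?P \<partial>?P) =
      (\<integral>\<^sup>+x. \<integral>\<^sup>+y. (f x * f y * f (\<lambda>k\<in>?I. x k - y k))\<^sup>2 \<partial>?P \<partial>?P)"
      by (intro nn_integral_cong) (auto simp: fS D_def indicator_def space_PiM)
    also have "\<dots> \<le> ennreal ((sqrt 3 / 2) ^ card ?I * (a * a * a)\<^sup>2)"
      by (rule sharp_young_PiM[OF _ bbs bbs bbs a(1) a(1) a(1) f_int f_int f_int]) simp
    also have "a * a * a = A" using a(2) by (simp add: power3_eq_cube)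
    finally show ?thesis by (simp add: q_def)
  qed
  \<comment> \<open>\<open>S\<close> need not be symmetric about the origin, so both orders are
    excluded. By Fubini's theorem both contribute equally, whence
    \<open>\<epsilon> = 2 * q\<close>.\<close>
  define E where "E = (\<lambda>x y. D x y \<or> D y x)"
  have "\<exists>xs. (\<forall>i<n. xs i \<in> S) \<and> (\<forall>i<n. \<forall>j<n. i \<noteq> j \<longrightarrow> \<not> E (xs i) (xs j))"
  proof (rule exists_pairwise_unrelated_points[where \<epsilon> = "2 * q"])
    show "sigma_finite_measure ?P" by (rule P.sigma_finite_measure_axioms)
    show "Measurable.pred (?P \<Otimes>\<^sub>M ?P) (\<lambda>(x, y). E x y)"
      unfolding E_def case_prod_beta' by measurable
    have "(\<integral>\<^sup>+x. emeasure ?P {y \<in> S. E x y} * indicator S x \<partial>?P) \<le>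
      (\<integral>\<^sup>+x. (\<integral>\<^sup>+y. indicator S x * indicator S y * (if D x y then 1 else 0) \<partial>?P) +
        (\<integral>\<^sup>+y. indicator S x * indicator S y * (if D y x then 1 else 0) \<partial>?P) \<partial>?P)"
    proof (rule nn_integral_mono)
      fix x assume x: "x \<in> space ?P"
      have D1: "Measurable.pred ?P (\<lambda>y. D x y)" "Measurable.pred ?P (\<lambda>y. D y x)"
        using x by (simp_all add: D_def) measurable
      have [measurable]: "{y \<in> S. E x y} \<in> sets ?P"
      proof -
        have "{y \<in> S. E x y} = {y \<in> space ?P. y \<in> S \<and> E x y}"
          using sets.sets_into_space[of S ?P] by auto
        thus ?thesis using D1 by (simp add: E_def)
      qed
      have "emeasure ?P {y \<in> S. E x y} * indicator S x =
        (\<integral>\<^sup>+y. indicator {y \<in> S. E x y} y * indicator S x \<partial>?P)"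
        by (subst nn_integral_multc) auto
      also have "\<dots> \<le> (\<integral>\<^sup>+y. indicator S x * indicator S y * (if D x y then 1 else 0) +
          indicator S x * indicator S y * (if D y x then 1 else 0) \<partial>?P)"
        by (intro nn_integral_mono) (auto simp: E_def indicator_def)
      also have "\<dots> = (\<integral>\<^sup>+y. indicator S x * indicator S y * (if D x y then 1 else 0) \<partial>?P) +
        (\<integral>\<^sup>+y. indicator S x * indicator S y * (if D y x then 1 else 0) \<partial>?P)"
        using D1 by (intro nn_integral_add borel_measurable_times_ennreal measurable_If) (auto simp: pred_def)
      finally show "emeasure ?P {y \<in> S. E x y} * indicator S x \<le> \<dots>" .
    qed
    also have "\<dots> = (\<integral>\<^sup>+x. \<integral>\<^sup>+y. indicator S x * indicator S y * (if D x y then 1 else 0) \<partial>?P \<partial>?P) +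
      (\<integral>\<^sup>+x. \<integral>\<^sup>+y. indicator S x * indicator S y * (if D y x then 1 else 0) \<partial>?P \<partial>?P)"
      by (intro nn_integral_add P.borel_measurable_nn_integral; unfold case_prod_beta'; measurable)
    also have "(\<integral>\<^sup>+x. \<integral>\<^sup>+y. indicator S x * indicator S y * (if D y x then 1 else 0) \<partial>?P \<partial>?P) =
      (\<integral>\<^sup>+y. \<integral>\<^sup>+x. indicator S y * indicator S x * (if D y x then 1 else 0) \<partial>?P \<partial>?P)"
    proof -
      interpret PP: pair_sigma_finite ?P ?P by standard
      show ?thesis
        by (subst PP.Fubini') (unfold case_prod_beta', measurable, simp add: mult.commute)
    qed
    also have "(\<integral>\<^sup>+x. \<integral>\<^sup>+y. indicator S x * indicator S y * (if D x y then 1 else 0) \<partial>?P \<partial>?P) +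
      (\<integral>\<^sup>+y. \<integral>\<^sup>+x. indicator S y * indicator S x * (if D y x then 1 else 0) \<partial>?P \<partial>?P) \<le>
      ennreal (q * A\<^sup>2) + ennreal (q * A\<^sup>2)"
      by (intro add_mono young)
    also have "\<dots> = ennreal (2 * q * A\<^sup>2)"
      by (subst ennreal_plus[symmetric]) (auto simp: q_def)
    finally show "(\<integral>\<^sup>+x. emeasure ?P {y \<in> S. E x y} * indicator S x \<partial>?P) \<le> ennreal (2 * q * A\<^sup>2)" .
  qed (use A n in \<open>auto simp: E_def q_def\<close>)
  then obtain xs where xs: "\<And>i. i < n \<Longrightarrow> xs i \<in> S" "\<And>i j. i < n \<Longrightarrow> j < n \<Longrightarrow> i \<noteq> j \<Longrightarrow> \<not> E (xs i) (xs j)"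
    by auto
  show ?thesis
  proof (intro exI[of _ "\<lambda>i. \<iota> (xs i)"] conjI allI impI)
    fix i assume i: "i < n"
    show "\<iota> (xs i) \<in> Rd d" by (simp add: \<iota>_def Rd_def)
    show "(\<lambda>k. \<iota> (xs i) k + p k) \<in> K" using xs(1)[OF i] by (simp add: S_def shift_def)
    fix j assume "j < n" "i \<noteq> j"
    hence "\<not> D (xs i) (xs j)" using xs(2) i by (auto simp: E_def)
    moreover have "(\<lambda>k\<in>?I. xs i k - xs j k) \<in> space ?P" by (simp add: space_PiM)
    moreover have "shift (\<lambda>k\<in>?I. xs i k - xs j k) = (\<lambda>k. \<iota> (xs i) k - \<iota> (xs j) k + p k)"
      by (auto simp: shift_def \<iota>_def fun_eq_iff)
    ultimately show "(\<lambda>k. \<iota> (xs i) k - \<iota> (xs j) k + p k) \<notin> K" by (simp add: D_def S_def)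
  qed
qed

text \<open>All the translates \<open>K - xs i\<close> contain \<open>p\<close>. The marked point
  \<open>p - xs i\<close> lies in \<open>K - xs j\<close> exactly if \<open>xs j - xs i + p\<close>
  lies in \<open>K\<close>, so the hypothesis is used with the indices exchanged.\<close>

lemma pi_strict_minkowski_of_difference_avoiding:
  assumes "\<And>i. i < n \<Longrightarrow> xs i \<in> Rd d" "\<And>i. i < n \<Longrightarrow> (\<lambda>k. xs i k + p k) \<in> K"
    and "\<And>i j. i < n \<Longrightarrow> j < n \<Longrightarrow> i \<noteq> j \<Longrightarrow> (\<lambda>k. xs i k - xs j k + p k) \<notin> K"
  shows "pi_strict_minkowski d K p n (\<lambda>i k. - xs i k) (\<lambda>_. 1)"
proof -
  have mem: "z \<in> homothet (\<lambda>k. - xs j k) 1 K \<longleftrightarrow> (\<lambda>k. z k + xs j k) \<in> K" for z j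
  proof
    assume "(\<lambda>k. z k + xs j k) \<in> K"
    thus "z \<in> homothet (\<lambda>k. - xs j k) 1 K"
      unfolding homothet_def by (rule rev_image_eqI) simp
  qed (auto simp: homothet_def)
  have "p \<in> homothet (\<lambda>k. - xs i k) 1 K" if "i < n" for i
    using assms(2)[OF that] by (simp add: mem add.commute)
  hence "homothet (\<lambda>k. - xs i k) 1 K \<inter> homothet (\<lambda>k. - xs j k) 1 K \<noteq> {}" if "i < n" "j < n" for i j
    using that by blast
  moreover have "(\<lambda>k. - xs i k + 1 * p k) \<notin> homothet (\<lambda>k. - xs j k) 1 K" if "i < n" "j < n" "i \<noteq> j" for i j
    using assms(3)[of j i] that by (simp add: mem algebra_simps)
  ultimately show ?thesis
    using assms(1) unfolding pi_strict_minkowski_def by (auto simp: Rd_def)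
qed

theorem theorem5:
  shows "\<exists>c::real. c > 0 \<and>
    (\<forall>d::nat. \<forall>K p. d \<ge> 1 \<longrightarrow> convex_body d K \<longrightarrow> p \<in> int_d d K \<longrightarrow>
       kappa' d K p > ereal (c * (2 / sqrt 3) ^ d))"
proof (intro exI[of _ "1/16"] conjI allI impI)
  fix d :: nat and K p assume K: "convex_body d K" and p: "p \<in> int_d d K"
  define Q where "Q = (2 / sqrt (3::real)) ^ d"
  have Q: "0 < Q" "(sqrt 3 / 2) ^ d = 1 / Q"
    by (simp_all add: Q_def power_divide)
  \<comment> \<open>The largest integer with \<open>n - 1 < Q / 8\<close>, which is the condition of
    the greedy choice.\<close>
  define n where "n = nat \<lceil>Q / 8\<rceil>"
  have n: "Q / 8 \<le> real n" "real n - 1 < Q / 8"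
    using Q(1) by (simp_all add: n_def, linarith)
  have "(real n - 1) * (8 * (sqrt 3 / 2) ^ d) < 1"
    using n(2) Q(1) unfolding Q(2) by (simp add: field_simps)
  from difference_avoiding_points[OF K p this] obtain xs where
    "\<And>i. i < n \<Longrightarrow> xs i \<in> Rd d" "\<And>i. i < n \<Longrightarrow> (\<lambda>k. xs i k + p k) \<in> K"
    "\<And>i j. i < n \<Longrightarrow> j < n \<Longrightarrow> i \<noteq> j \<Longrightarrow> (\<lambda>k. xs i k - xs j k + p k) \<notin> K" by blast
  from pi_strict_minkowski_of_difference_avoiding[of n xs, OF this]
  have "ereal (real n) \<le> kappa' d K p"
    unfolding kappa'_def by (intro Sup_upper) blast
  moreover have "1 / 16 * Q < real n" using n(1) Q(1) by linarith
  ultimately show "ereal (1 / 16 * (2 / sqrt 3) ^ d) < kappa' d K p"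
    unfolding Q_def[symmetric] by (meson less_ereal.simps(1) less_le_trans)
qed simp

end
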